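(* For any $0<\lambda\leq 1$ and any strictly positive operators $A_1,B_1$ on a Hilbert space $\mathcal{H}_1$ and $A_2,B_2$ on a Hilbert space $\mathcal{H}_2$, we have $$T_{\lambda}(A_1\otimes A_2\vert B_1\otimes B_2)=T_{\lambda}(A_1\vert B_1)\otimes A_2+A_1\otimes T_{\lambda}(A_2\vert B_2)+\lambda\,T_{\lambda}(A_1\vert B_1)\otimes T_{\lambda}(A_2\vert B_2).$$
   Context: Operators are bounded linear operators on a Hilbert space; strictly positive means positive and invertible. For strictly positive operators $A,B$ on the same Hilbert space and $\lambda\in(0,1]$, the Tsallis relative operator entropy is $T_{\lambda}(A\vert B):=\frac{1}{\lambda}\left(A^{1/2}(A^{-1/2}BA^{-1/2})^{\lambda}A^{1/2}-A\right)$. The symbol $\otimes$ denotes the tensor product of operators, acting on the Hilbert space tensor product $\mathcal{H}_1\otimes\mathcal{H}_2$. *)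

theory Defs
  imports "HOL-Analysis.Analysis" "HOL-Computational_Algebra.Polynomial"
begin

section \<open>Complex Hilbert spaces\<close>

text \<open>The inner product is linear in its second argument.  Positive definiteness and the relation
  between norm and inner product are inherited from \<^class>\<open>real_inner\<close> through \<open>Re_cinner\<close>.\<close>

class complex_inner = real_inner +
  fixes scaleC :: "complex \<Rightarrow> 'a \<Rightarrow> 'a"  (infixr \<open>*\<^sub>C\<close> 75)
    and cinner :: "'a \<Rightarrow> 'a \<Rightarrow> complex"  (\<open>\<langle>_,/ _\<rangle>\<close>)
  assumes scaleC_add_right: "a *\<^sub>C (x + y) = a *\<^sub>C x + a *\<^sub>C y"
    and scaleC_add_left: "(a + b) *\<^sub>C x = a *\<^sub>C x + b *\<^sub>C x"
    and scaleC_scaleC [simp]: "a *\<^sub>C b *\<^sub>C x = (a * b) *\<^sub>C x"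
    and scaleC_of_real: "complex_of_real r *\<^sub>C x = r *\<^sub>R x"
    and cinner_commute: "\<langle>x, y\<rangle> = cnj \<langle>y, x\<rangle>"
    and cinner_add_right: "\<langle>x, y + z\<rangle> = \<langle>x, y\<rangle> + \<langle>x, z\<rangle>"
    and cinner_scaleC_right [simp]: "\<langle>x, a *\<^sub>C y\<rangle> = a * \<langle>x, y\<rangle>"
    and Re_cinner: "Re \<langle>x, y\<rangle> = inner x y"

class chilbert_space = complex_inner + complete_space

context complex_inner
begin

lemma cinner_add_left: "\<langle>x + y, z\<rangle> = \<langle>x, z\<rangle> + \<langle>y, z\<rangle>"
  by (metis cinner_commute cinner_add_right complex_cnj_add)

lemma cinner_scaleC_left [simp]: "\<langle>a *\<^sub>C x, y\<rangle> = cnj a * \<langle>x, y\<rangle>"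
  by (metis cinner_commute cinner_scaleC_right complex_cnj_mult)

lemma cinner_zero_right [simp]: "\<langle>x, 0\<rangle> = 0"
  using cinner_add_right [of x 0 0] by simp

lemma cinner_zero_left [simp]: "\<langle>0, x\<rangle> = 0"
  using cinner_add_left [of 0 0 x] by simp

lemma cinner_diff_right: "\<langle>x, y - z\<rangle> = \<langle>x, y\<rangle> - \<langle>x, z\<rangle>"
  using cinner_add_right [of x "y - z" z] by simp

lemma cinner_sum_right: "\<langle>x, \<Sum>i\<in>I. f i\<rangle> = (\<Sum>i\<in>I. \<langle>x, f i\<rangle>)"
  by (induction I rule: infinite_finite_induct) (auto simp: cinner_add_right)

lemma cinner_self: "\<langle>x, x\<rangle> = complex_of_real (inner x x)"
proof -
  have "Im \<langle>x, x\<rangle> = - Im \<langle>x, x\<rangle>"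
    by (metis cinner_commute cnj.simps(2))
  then show ?thesis
    by (simp add: complex_eq_iff Re_cinner)
qed

lemma cinner_self_eq_0 [simp]: "\<langle>x, x\<rangle> = 0 \<longleftrightarrow> x = 0"
  by (simp add: cinner_self)

end

lemma scaleC_one [simp]: "1 *\<^sub>C x = (x :: 'a::complex_inner)"
  using scaleC_of_real [of 1 x] by simp

lemma scaleC_minus1 [simp]: "(-1) *\<^sub>C x = - (x :: 'a::complex_inner)"
  using scaleC_of_real [of "-1" x] by simp

lemma norm_scaleC: "norm (a *\<^sub>C x) = cmod a * norm (x :: 'a::complex_inner)"
proof -
  have "inner (a *\<^sub>C x) (a *\<^sub>C x) = Re (cnj a * a * \<langle>x, x\<rangle>)"
    by (simp add: Re_cinner [symmetric] mult_ac)
  also have "\<dots> = (cmod a)\<^sup>2 * inner x x"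
    by (metis cinner_self complex_norm_square mult.commute of_real_mult Re_complex_of_real)
  finally show ?thesis
    by (simp add: norm_eq_sqrt_inner real_sqrt_mult)
qed

lemma bounded_linear_scaleC: "bounded_linear (\<lambda>x :: 'a::complex_inner. z *\<^sub>C x)"
proof (rule bounded_linear_intro [where K = "cmod z"])
  show "z *\<^sub>C (r *\<^sub>R x) = r *\<^sub>R z *\<^sub>C x" for r and x :: 'a
    by (metis scaleC_of_real scaleC_scaleC mult.commute)
qed (simp_all add: scaleC_add_right norm_scaleC mult.commute)

instantiation complex :: chilbert_space
begin

definition scaleC_complex :: "complex \<Rightarrow> complex \<Rightarrow> complex" where
  "scaleC_complex a x = a * x"

definition cinner_complex :: "complex \<Rightarrow> complex \<Rightarrow> complex" where
  "cinner_complex x y = cnj x * y"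

instance
  by standard (simp_all add: scaleC_complex_def cinner_complex_def inner_complex_def
      distrib_left distrib_right scaleR_conv_of_real)

end


section \<open>The Hilbert space tensor product\<close>

text \<open>The tensor product is the completion of the algebraic tensor product with respect to the inner
  product determined by \<open>\<langle>u \<otimes> v, x \<otimes> y\<rangle> = \<langle>u, x\<rangle> \<langle>v, y\<rangle>\<close>.  A list of pairs stands for the formal sum
  of the corresponding elementary tensors; \<open>ts_form\<close> is the resulting positive semidefinite form.
  Separation and completion are done in one step: elements of the tensor product are Cauchy sequences
  of formal sums modulo sequences whose seminorm tends to zero.\<close>

definition ts_form :: "('a::complex_inner \<times> 'b::complex_inner) list \<Rightarrow> ('a \<times> 'b) list \<Rightarrow> complex" where
  "ts_form s t = (\<Sum>(u, v)\<leftarrow>s. \<Sum>(x, y)\<leftarrow>t. \<langle>u, x\<rangle> * \<langle>v, y\<rangle>)"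

definition ts_scale :: "complex \<Rightarrow> ('a::complex_inner \<times> 'b::complex_inner) list \<Rightarrow> ('a \<times> 'b) list" where
  "ts_scale c = map (\<lambda>(x, y). (c *\<^sub>C x, y))"

definition ts_diff :: "('a::complex_inner \<times> 'b::complex_inner) list \<Rightarrow> ('a \<times> 'b) list \<Rightarrow> ('a \<times> 'b) list" where
  "ts_diff s t = s @ ts_scale (-1) t"

definition ts_norm :: "('a::complex_inner \<times> 'b::complex_inner) list \<Rightarrow> real" where
  "ts_norm s = sqrt (Re (ts_form s s))"

definition ts_Cauchy :: "(nat \<Rightarrow> ('a::complex_inner \<times> 'b::complex_inner) list) \<Rightarrow> bool" where
  "ts_Cauchy X \<longleftrightarrow> (\<forall>e>0. \<exists>N. \<forall>m\<ge>N. \<forall>n\<ge>N. ts_norm (ts_diff (X m) (X n)) < e)"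

definition ts_equiv :: "(nat \<Rightarrow> ('a::complex_inner \<times> 'b::complex_inner) list) \<Rightarrow> (nat \<Rightarrow> ('a \<times> 'b) list) \<Rightarrow> bool" where
  "ts_equiv X Y \<longleftrightarrow> ts_Cauchy X \<and> ts_Cauchy Y \<and> (\<lambda>n. ts_norm (ts_diff (X n) (Y n))) \<longlonglongrightarrow> 0"

lemma ts_form_Nil [simp]: "ts_form [] t = 0" "ts_form s [] = 0"
  by (simp_all add: ts_form_def case_prod_unfold)

lemma ts_form_append [simp]:
  "ts_form (s @ s') t = ts_form s t + ts_form s' t"
  "ts_form s (t @ t') = ts_form s t + ts_form s t'"
  by (simp_all add: ts_form_def case_prod_unfold sum_list_addf)

lemma ts_form_scale [simp]:
  "ts_form (ts_scale c s) t = cnj c * ts_form s t"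
  "ts_form s (ts_scale c t) = c * ts_form s t"
  by (simp_all add: ts_form_def ts_scale_def case_prod_unfold o_def sum_list_const_mult mult_ac
      flip: sum_list_const_mult)

lemma ts_form_diff [simp]:
  "ts_form (ts_diff s s') t = ts_form s t - ts_form s' t"
  "ts_form s (ts_diff t t') = ts_form s t - ts_form s t'"
  by (simp_all add: ts_diff_def)

lemma ts_form_Cons: "ts_form s (p # t) = ts_form s [p] + ts_form s t"
  using ts_form_append(2) [of s "[p]" t] by simp

lemma ts_form_single: "ts_form [(u, v)] [(x, y)] = \<langle>u, x\<rangle> * \<langle>v, y\<rangle>"
  by (simp add: ts_form_def)

lemma ts_form_Cons_left: "ts_form (p # s) t = ts_form [p] t + ts_form s t"
  using ts_form_append(1) [of "[p]" s t] by simp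

lemma ts_form_commute: "ts_form s t = cnj (ts_form t s)"
proof (induction s)
  case (Cons p s)
  obtain u v where p: "p = (u, v)" by fastforce
  have "ts_form [p] t = cnj (ts_form t [p])"
  proof (induction t)
    case (Cons q t)
    have "ts_form [p] [q] = cnj (ts_form [q] [p])"
      by (cases q) (metis p ts_form_single cinner_commute complex_cnj_mult)
    with Cons show ?case
      by (metis ts_form_Cons ts_form_Cons_left complex_cnj_add)
  qed simp
  with Cons show ?case
    by (metis ts_form_Cons ts_form_Cons_left complex_cnj_add)
qed simp

lemma ts_orthogonalize:
  fixes s :: "('a::complex_inner \<times> 'b::complex_inner) list"
  shows "\<exists>n (z :: nat \<Rightarrow> 'a) (e :: nat \<Rightarrow> 'b). (\<forall>j<n. \<forall>k<n. j \<noteq> k \<longrightarrow> \<langle>e j, e k\<rangle> = 0) \<and>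
    (\<forall>u v. ts_form [(u, v)] s = (\<Sum>k<n. \<langle>u, z k\<rangle> * \<langle>v, e k\<rangle>))"
proof (induction s)
  case Nil
  then show ?case by (rule exI [of _ 0]) simp
next
  case (Cons p s)
  obtain x y where p: "p = (x, y)" by fastforce
  from Cons.IH obtain n and z :: "nat \<Rightarrow> 'a" and e :: "nat \<Rightarrow> 'b"
    where *: "(\<forall>j<n. \<forall>k<n. j \<noteq> k \<longrightarrow> \<langle>e j, e k\<rangle> = 0) \<and>
      (\<forall>u v. ts_form [(u, v)] s = (\<Sum>k<n. \<langle>u, z k\<rangle> * \<langle>v, e k\<rangle>))"
    by (elim exE) (rule that)
  have orth: "\<langle>e j, e k\<rangle> = 0" if "j < n" "k < n" "j \<noteq> k" for j k
    using * that by simp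
  have form: "ts_form [(u, v)] s = (\<Sum>k<n. \<langle>u, z k\<rangle> * \<langle>v, e k\<rangle>)" for u v
    using * by simp
  define c where "c k = \<langle>e k, y\<rangle> / \<langle>e k, e k\<rangle>" for k
  define r where "r = y - (\<Sum>k<n. c k *\<^sub>C e k)"
  have er: "\<langle>e j, r\<rangle> = 0" if "j < n" for j
  proof -
    have "(\<Sum>k<n. c k * \<langle>e j, e k\<rangle>) = (\<Sum>k<n. if k = j then c j * \<langle>e j, e j\<rangle> else 0)"
      using orth that by (intro sum.cong) auto
    then have "\<langle>e j, r\<rangle> = \<langle>e j, y\<rangle> - c j * \<langle>e j, e j\<rangle>"
      using that by (simp add: r_def cinner_diff_right cinner_sum_right)
    then show ?thesis
      by (auto simp: c_def)
  qed
  have re: "\<langle>r, e j\<rangle> = 0" if "j < n" for j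
    using er [OF that] by (metis cinner_commute complex_cnj_zero)
  have y: "y = (\<Sum>k<n. c k *\<^sub>C e k) + r"
    by (simp add: r_def)
  define z' where "z' k = (if k < n then z k + c k *\<^sub>C x else x)" for k
  define e' where "e' k = (if k < n then e k else r)" for k
  have "ts_form [(u, v)] (p # s) = (\<Sum>k<Suc n. \<langle>u, z' k\<rangle> * \<langle>v, e' k\<rangle>)" for u v
  proof -
    have "ts_form [(u, v)] (p # s) = \<langle>u, x\<rangle> * \<langle>v, y\<rangle> + (\<Sum>k<n. \<langle>u, z k\<rangle> * \<langle>v, e k\<rangle>)"
      by (subst ts_form_Cons) (simp add: p form ts_form_single)
    also have "\<langle>u, x\<rangle> * \<langle>v, y\<rangle> = (\<Sum>k<n. c k * \<langle>u, x\<rangle> * \<langle>v, e k\<rangle>) + \<langle>u, x\<rangle> * \<langle>v, r\<rangle>"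
      by (subst y) (simp add: cinner_add_right cinner_sum_right distrib_left sum_distrib_left mult_ac)
    finally show ?thesis
      by (simp add: z'_def e'_def cinner_add_right distrib_right sum.distrib)
  qed
  moreover have "\<forall>j<Suc n. \<forall>k<Suc n. j \<noteq> k \<longrightarrow> \<langle>e' j, e' k\<rangle> = 0"
    using orth er re by (auto simp: e'_def less_Suc_eq)
  ultimately show ?case by blast
qed

lemma ts_form_nonneg:
  fixes s :: "('a::complex_inner \<times> 'b::complex_inner) list"
  shows "0 \<le> Re (ts_form s s)"
proof -
  obtain n and z :: "nat \<Rightarrow> 'a" and e :: "nat \<Rightarrow> 'b"
    where *: "(\<forall>j<n. \<forall>k<n. j \<noteq> k \<longrightarrow> \<langle>e j, e k\<rangle> = 0) \<and>
      (\<forall>u v. ts_form [(u, v)] s = (\<Sum>k<n. \<langle>u, z k\<rangle> * \<langle>v, e k\<rangle>))"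
    using ts_orthogonalize [of s]
    by (elim exE) (rule that)
  have orth: "\<langle>e j, e k\<rangle> = 0" if "j < n" "k < n" "j \<noteq> k" for j k
    using * that by simp
  have form: "ts_form [(u, v)] s = (\<Sum>k<n. \<langle>u, z k\<rangle> * \<langle>v, e k\<rangle>)" for u v
    using * by simp
  have left: "ts_form t s = (\<Sum>k<n. cnj (ts_form [(z k, e k)] t))" for t
  proof (induction t)
    case (Cons p t)
    obtain u v where p: "p = (u, v)" by fastforce
    have "ts_form [p] s = (\<Sum>k<n. cnj (ts_form [(z k, e k)] [p]))"
      unfolding p form ts_form_single
      by (intro sum.cong refl) (metis cinner_commute complex_cnj_mult)
    then show ?case
      by (subst ts_form_Cons_left, subst ts_form_Cons) (simp add: Cons sum.distrib)
  qed simp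
  have "ts_form [(z k, e k)] s = complex_of_real (inner (z k) (z k) * inner (e k) (e k))"
    if "k < n" for k
  proof -
    have "(\<Sum>j<n. \<langle>z k, z j\<rangle> * \<langle>e k, e j\<rangle>) = (\<Sum>j<n. if j = k then \<langle>z k, z k\<rangle> * \<langle>e k, e k\<rangle> else 0)"
      using orth that by (intro sum.cong) auto
    then show ?thesis
      using that by (simp add: form cinner_self)
  qed
  then have "ts_form s s = (\<Sum>k<n. complex_of_real (inner (z k) (z k) * inner (e k) (e k)))"
    by (subst left) simp
  then show ?thesis
    by (simp add: sum_nonneg)
qed

lemma ts_form_self: "ts_form s s = complex_of_real ((ts_norm s)\<^sup>2)"
proof -
  have "Im (ts_form s s) = - Im (ts_form s s)"
    by (metis ts_form_commute cnj.simps(2))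
  then show ?thesis
    by (simp add: complex_eq_iff ts_norm_def ts_form_nonneg)
qed

lemma ts_norm_nonneg [simp]: "0 \<le> ts_norm s"
  by (simp add: ts_norm_def ts_form_nonneg)

lemma ts_Cauchy_Schwarz: "Re (ts_form s t) \<le> ts_norm s * ts_norm t"
proof -
  let ?a = "(ts_norm s)\<^sup>2" and ?b = "(ts_norm t)\<^sup>2" and ?r = "Re (ts_form s t)"
  have *: "0 \<le> ?a - 2 * c * ?r + c\<^sup>2 * ?b" for c
  proof -
    have "Re (ts_form t s) = ?r"
      by (metis ts_form_commute cnj.simps(1))
    then show ?thesis
      using ts_form_nonneg [of "ts_diff s (ts_scale (of_real c) t)"]
      by (simp add: ts_form_self [of s] ts_form_self [of t] algebra_simps power2_eq_square)
  qed
  have "?r\<^sup>2 \<le> ?a * ?b"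
  proof (cases "?b = 0")
    case True
    have "?r = 0"
    proof (rule ccontr)
      assume "?r \<noteq> 0"
      then show False
        using * [of "(?a + 1) / (2 * ?r)"] True by (simp add: field_simps)
    qed
    then show ?thesis by simp
  next
    case False
    then have b: "?b > 0" by simp
    have "0 \<le> ?b * (?a - 2 * (?r / ?b) * ?r + (?r / ?b)\<^sup>2 * ?b)"
      by (rule mult_nonneg_nonneg [OF less_imp_le [OF b] *])
    also have "\<dots> = ?a * ?b - ?r\<^sup>2"
      using False by (simp add: field_simps power2_eq_square)
    finally show ?thesis by simp
  qed
  then have "?r\<^sup>2 \<le> (ts_norm s * ts_norm t)\<^sup>2"
    by (simp add: power_mult_distrib)
  then show ?thesis
    by (rule power2_le_imp_le) simp
qed

lemma ts_norm_append: "ts_norm (s @ t) \<le> ts_norm s + ts_norm t"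
proof (rule power2_le_imp_le)
  have "Re (ts_form t s) = Re (ts_form s t)"
    by (metis ts_form_commute cnj.simps(1))
  then have "(ts_norm (s @ t))\<^sup>2 = (ts_norm s)\<^sup>2 + 2 * Re (ts_form s t) + (ts_norm t)\<^sup>2"
    by (simp add: ts_norm_def ts_form_nonneg ts_form_append [symmetric] del: ts_form_append)
       (simp add: ts_form_nonneg)
  then show "(ts_norm (s @ t))\<^sup>2 \<le> (ts_norm s + ts_norm t)\<^sup>2"
    using ts_Cauchy_Schwarz [of s t] by (simp add: power2_sum)
qed simp

lemma ts_norm_cong:
  assumes "\<And>r. ts_form r s = ts_form r t"
  shows "ts_norm s = ts_norm t"
  using assms by (metis ts_norm_def ts_form_commute)

lemma ts_norm_scale [simp]: "ts_norm (ts_scale c s) = cmod c * ts_norm s"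
proof -
  have "ts_form (ts_scale c s) (ts_scale c s) = complex_of_real ((cmod c * ts_norm s)\<^sup>2)"
    by (simp add: ts_form_self [of s] power_mult_distrib complex_norm_square
        del: of_real_power)
  then have "ts_norm (ts_scale c s) = sqrt ((cmod c * ts_norm s)\<^sup>2)"
    by (metis ts_norm_def Re_complex_of_real)
  then show ?thesis by simp
qed

lemma ts_norm_Nil [simp]: "ts_norm [] = 0"
  by (simp add: ts_norm_def)

lemma ts_norm_0I: "(\<And>r. ts_form r s = 0) \<Longrightarrow> ts_norm s = 0"
  by (simp add: ts_norm_def)

lemma ts_diff_triangle: "ts_norm (ts_diff s u) \<le> ts_norm (ts_diff s t) + ts_norm (ts_diff t u)"
proof -
  have "ts_norm (ts_diff s u) = ts_norm (ts_diff s t @ ts_diff t u)"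
    by (rule ts_norm_cong) simp
  then show ?thesis
    using ts_norm_append by metis
qed

lemma ts_diff_commute: "ts_norm (ts_diff s t) = ts_norm (ts_diff t s)"
proof -
  have "ts_norm (ts_diff s t) = ts_norm (ts_scale (-1) (ts_diff t s))"
    by (rule ts_norm_cong) simp
  then show ?thesis by simp
qed

lemma ts_norm_abs_diff: "\<bar>ts_norm s - ts_norm t\<bar> \<le> ts_norm (ts_diff s t)"
proof -
  have *: "ts_norm s \<le> ts_norm (ts_diff s t) + ts_norm t" for s t :: "('a \<times> 'b) list"
  proof -
    have "ts_norm s = ts_norm (ts_diff s t @ t)"
      by (rule ts_norm_cong) simp
    then show ?thesis
      using ts_norm_append by metis
  qed
  show ?thesis
    using * [of s t] * [of t s] ts_diff_commute [of s t] by linarith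
qed

lemma ts_norm_diff_append:
  "ts_norm (ts_diff (s @ t) (s' @ t')) \<le> ts_norm (ts_diff s s') + ts_norm (ts_diff t t')"
proof -
  have "ts_norm (ts_diff (s @ t) (s' @ t')) = ts_norm (ts_diff s s' @ ts_diff t t')"
    by (rule ts_norm_cong) simp
  then show ?thesis
    using ts_norm_append by metis
qed

lemma ts_norm_diff_scale:
  "ts_norm (ts_diff (ts_scale c s) (ts_scale c t)) = cmod c * ts_norm (ts_diff s t)"
proof -
  have "ts_norm (ts_diff (ts_scale c s) (ts_scale c t)) = ts_norm (ts_scale c (ts_diff s t))"
    by (rule ts_norm_cong) (simp add: right_diff_distrib)
  then show ?thesis by simp
qed

lemma ts_form_polarization:
  "ts_form s t = complex_of_real (((ts_norm (s @ t))\<^sup>2 - (ts_norm (ts_diff s t))\<^sup>2) / 4)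
     - \<i> * complex_of_real (((ts_norm (s @ ts_scale \<i> t))\<^sup>2 - (ts_norm (ts_diff s (ts_scale \<i> t)))\<^sup>2) / 4)"
proof -
  have *: "((ts_norm (s @ t))\<^sup>2 - (ts_norm (ts_diff s t))\<^sup>2) / 4 = Re (ts_form s t)" for t
  proof -
    have "Re (ts_form t s) = Re (ts_form s t)"
      by (metis ts_form_commute cnj.simps(1))
    then show ?thesis
      using ts_form_nonneg [of "s @ t"] ts_form_nonneg [of "ts_diff s t"]
      by (simp add: ts_norm_def)
  qed
  show ?thesis
    unfolding * by (simp add: complex_eq_iff)
qed

lemma ts_Cauchy_const [simp]: "ts_Cauchy (\<lambda>_. s)"
proof -
  have "ts_norm (ts_diff s s) = 0"
    by (rule ts_norm_0I) simp
  then show ?thesis by (simp add: ts_Cauchy_def)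
qed

lemma ts_Cauchy_append:
  assumes "ts_Cauchy X" "ts_Cauchy Y"
  shows "ts_Cauchy (\<lambda>n. X n @ Y n)"
  unfolding ts_Cauchy_def
proof (intro allI impI)
  fix e :: real assume "e > 0"
  then have e: "e / 2 > 0" by simp
  obtain M where M: "\<forall>m\<ge>M. \<forall>n\<ge>M. ts_norm (ts_diff (X m) (X n)) < e / 2"
    using assms(1) e unfolding ts_Cauchy_def by blast
  obtain N where N: "\<forall>m\<ge>N. \<forall>n\<ge>N. ts_norm (ts_diff (Y m) (Y n)) < e / 2"
    using assms(2) e unfolding ts_Cauchy_def by blast
  have "ts_norm (ts_diff (X m @ Y m) (X n @ Y n)) < e" if "m \<ge> max M N" "n \<ge> max M N" for m n
    using M [rule_format, of m n] N [rule_format, of m n] that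
      ts_norm_diff_append [of "X m" "Y m" "X n" "Y n"] by simp
  then show "\<exists>N. \<forall>m\<ge>N. \<forall>n\<ge>N. ts_norm (ts_diff (X m @ Y m) (X n @ Y n)) < e"
    by blast
qed

lemma ts_Cauchy_scale:
  assumes "ts_Cauchy X"
  shows "ts_Cauchy (\<lambda>n. ts_scale c (X n))"
  unfolding ts_Cauchy_def
proof (intro allI impI)
  fix e :: real assume "e > 0"
  then have "e / (cmod c + 1) > 0"
    by (simp add: add_nonneg_pos)
  then obtain N where N: "\<And>m n. m \<ge> N \<Longrightarrow> n \<ge> N \<Longrightarrow> ts_norm (ts_diff (X m) (X n)) < e / (cmod c + 1)"
    using assms unfolding ts_Cauchy_def by blast
  have "ts_norm (ts_diff (ts_scale c (X m)) (ts_scale c (X n))) < e" if "m \<ge> N" "n \<ge> N" for m n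
  proof -
    have "cmod c * ts_norm (ts_diff (X m) (X n)) \<le> (cmod c + 1) * ts_norm (ts_diff (X m) (X n))"
      by (intro mult_right_mono) auto
    also have "\<dots> < e"
      using N [OF that] by (simp add: pos_less_divide_eq add_nonneg_pos mult.commute)
    finally show ?thesis
      by (simp add: ts_norm_diff_scale)
  qed
  then show "\<exists>N. \<forall>m\<ge>N. \<forall>n\<ge>N. ts_norm (ts_diff (ts_scale c (X m)) (ts_scale c (X n))) < e"
    by blast
qed

lemma ts_Cauchy_norm:
  assumes "ts_Cauchy X"
  shows "convergent (\<lambda>n. ts_norm (X n))"
proof -
  have "Cauchy (\<lambda>n. ts_norm (X n))"
    unfolding Cauchy_def dist_real_def
    using assms ts_norm_abs_diff unfolding ts_Cauchy_def by (meson order_le_less_trans)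
  then show ?thesis
    by (simp add: Cauchy_convergent_iff)
qed

lemma ts_equiv_refl: "ts_equiv X X \<longleftrightarrow> ts_Cauchy X"
proof -
  have "ts_norm (ts_diff s s) = 0" for s :: "('a \<times> 'b) list"
    by (rule ts_norm_0I) simp
  then show ?thesis by (simp add: ts_equiv_def)
qed

lemma ts_equivI:
  assumes "ts_Cauchy X" "ts_Cauchy Y" "\<And>n r. ts_form r (X n) = ts_form r (Y n)"
  shows "ts_equiv X Y"
proof -
  have "ts_norm (ts_diff (X n) (Y n)) = 0" for n
    by (rule ts_norm_0I) (simp add: assms(3))
  then show ?thesis by (simp add: ts_equiv_def assms)
qed

lemma ts_equiv_sym: "ts_equiv X Y \<Longrightarrow> ts_equiv Y X"
  by (simp add: ts_equiv_def ts_diff_commute)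

lemma ts_equiv_trans:
  assumes "ts_equiv X Y" "ts_equiv Y Z"
  shows "ts_equiv X Z"
proof -
  have "(\<lambda>n. ts_norm (ts_diff (X n) (Y n)) + ts_norm (ts_diff (Y n) (Z n))) \<longlonglongrightarrow> 0"
    using assms tendsto_add [of _ 0 _ _ "0::real"] unfolding ts_equiv_def by fastforce
  then have "(\<lambda>n. ts_norm (ts_diff (X n) (Z n))) \<longlonglongrightarrow> 0"
    by (rule tendsto_0_le [where K = 1]) (auto simp: ts_diff_triangle)
  then show ?thesis
    using assms by (simp add: ts_equiv_def)
qed

lemma ts_equiv_append:
  assumes "ts_equiv X X'" "ts_equiv Y Y'"
  shows "ts_equiv (\<lambda>n. X n @ Y n) (\<lambda>n. X' n @ Y' n)"
proof -
  have "(\<lambda>n. ts_norm (ts_diff (X n) (X' n)) + ts_norm (ts_diff (Y n) (Y' n))) \<longlonglongrightarrow> 0"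
    using assms tendsto_add [of _ 0 _ _ "0::real"] unfolding ts_equiv_def by fastforce
  then have "(\<lambda>n. ts_norm (ts_diff (X n @ Y n) (X' n @ Y' n))) \<longlonglongrightarrow> 0"
    by (rule tendsto_0_le [where K = 1]) (auto simp: ts_norm_diff_append)
  then show ?thesis
    using assms by (simp add: ts_equiv_def ts_Cauchy_append)
qed

lemma ts_equiv_scale:
  assumes "ts_equiv X X'"
  shows "ts_equiv (\<lambda>n. ts_scale c (X n)) (\<lambda>n. ts_scale c (X' n))"
  using assms by (simp add: ts_equiv_def ts_Cauchy_scale ts_norm_diff_scale tendsto_mult_right_zero)

lemma ts_equiv_norm:
  assumes "ts_equiv X Y"
  shows "(\<lambda>n. (ts_norm (X n))\<^sup>2 - (ts_norm (Y n))\<^sup>2) \<longlonglongrightarrow> 0"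
proof -
  have "(\<lambda>n. ts_norm (ts_diff (X n) (Y n))) \<longlonglongrightarrow> 0"
    using assms by (simp add: ts_equiv_def)
  then have "(\<lambda>n. ts_norm (X n) - ts_norm (Y n)) \<longlonglongrightarrow> 0"
    by (rule tendsto_0_le [where K = 1]) (auto simp: ts_norm_abs_diff)
  moreover obtain a b where "(\<lambda>n. ts_norm (X n)) \<longlonglongrightarrow> a" "(\<lambda>n. ts_norm (Y n)) \<longlonglongrightarrow> b"
    using assms ts_Cauchy_norm unfolding ts_equiv_def convergent_def by metis
  ultimately have "(\<lambda>n. (ts_norm (X n) - ts_norm (Y n)) * (ts_norm (X n) + ts_norm (Y n))) \<longlonglongrightarrow> 0 * (a + b)"
    by (intro tendsto_intros)
  then show ?thesis
    by (simp add: power2_eq_square algebra_simps)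
qed

lemma ts_Cauchy_diff: "ts_Cauchy X \<Longrightarrow> ts_Cauchy Y \<Longrightarrow> ts_Cauchy (\<lambda>n. ts_diff (X n) (Y n))"
  by (simp add: ts_diff_def ts_Cauchy_append ts_Cauchy_scale)

lemma ts_equiv_diff: "ts_equiv X X' \<Longrightarrow> ts_equiv Y Y' \<Longrightarrow>
    ts_equiv (\<lambda>n. ts_diff (X n) (Y n)) (\<lambda>n. ts_diff (X' n) (Y' n))"
  by (simp add: ts_diff_def ts_equiv_append ts_equiv_scale)

lemma ts_form_LIMSEQ:
  assumes "ts_Cauchy X" "ts_Cauchy Y"
  shows "(\<lambda>n. ts_form (X n) (Y n)) \<longlonglongrightarrow> lim (\<lambda>n. ts_form (X n) (Y n))"
proof -
  have *: "\<exists>a. (\<lambda>n. ts_norm (Z n)) \<longlonglongrightarrow> a" if "ts_Cauchy Z" for Z :: "nat \<Rightarrow> ('a \<times> 'b) list"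
    using ts_Cauchy_norm [OF that] by (simp add: convergent_def)
  obtain a where "(\<lambda>n. ts_norm (X n @ Y n)) \<longlonglongrightarrow> a"
    using * assms ts_Cauchy_append by metis
  moreover obtain b where "(\<lambda>n. ts_norm (ts_diff (X n) (Y n))) \<longlonglongrightarrow> b"
    using * assms ts_Cauchy_diff by metis
  moreover obtain c where "(\<lambda>n. ts_norm (X n @ ts_scale \<i> (Y n))) \<longlonglongrightarrow> c"
    using * assms ts_Cauchy_append ts_Cauchy_scale by metis
  moreover obtain d where "(\<lambda>n. ts_norm (ts_diff (X n) (ts_scale \<i> (Y n)))) \<longlonglongrightarrow> d"
    using * assms ts_Cauchy_diff ts_Cauchy_scale by metis
  ultimately have "(\<lambda>n. complex_of_real (((ts_norm (X n @ Y n))\<^sup>2 - (ts_norm (ts_diff (X n) (Y n)))\<^sup>2) / 4)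
     - \<i> * complex_of_real (((ts_norm (X n @ ts_scale \<i> (Y n)))\<^sup>2 - (ts_norm (ts_diff (X n) (ts_scale \<i> (Y n))))\<^sup>2) / 4))
     \<longlonglongrightarrow> complex_of_real ((a\<^sup>2 - b\<^sup>2) / 4) - \<i> * complex_of_real ((c\<^sup>2 - d\<^sup>2) / 4)"
    by (intro tendsto_intros) auto
  then have "convergent (\<lambda>n. ts_form (X n) (Y n))"
    by (subst ts_form_polarization) (auto simp: convergent_def)
  then show ?thesis
    by (simp add: convergent_LIMSEQ_iff)
qed

lemma ts_form_lim_cong:
  assumes "ts_equiv X X'" "ts_equiv Y Y'"
  shows "lim (\<lambda>n. ts_form (X n) (Y n)) = lim (\<lambda>n. ts_form (X' n) (Y' n))"
proof -
  let ?N = "\<lambda>s :: ('a \<times> 'b) list. (ts_norm s)\<^sup>2"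
  have Z: "(\<lambda>n. ?N (X n @ Z n) - ?N (X' n @ Z' n)) \<longlonglongrightarrow> 0"
    "(\<lambda>n. ?N (ts_diff (X n) (Z n)) - ?N (ts_diff (X' n) (Z' n))) \<longlonglongrightarrow> 0"
    if "ts_equiv Z Z'" for Z Z'
    using that assms by (auto intro!: ts_equiv_norm ts_equiv_append ts_equiv_diff)
  have iY: "ts_equiv (\<lambda>n. ts_scale \<i> (Y n)) (\<lambda>n. ts_scale \<i> (Y' n))"
    by (rule ts_equiv_scale) fact
  have "(\<lambda>n. complex_of_real (((?N (X n @ Y n) - ?N (X' n @ Y' n)) -
           (?N (ts_diff (X n) (Y n)) - ?N (ts_diff (X' n) (Y' n)))) / 4)
      - \<i> * complex_of_real (((?N (X n @ ts_scale \<i> (Y n)) - ?N (X' n @ ts_scale \<i> (Y' n))) -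
           (?N (ts_diff (X n) (ts_scale \<i> (Y n))) - ?N (ts_diff (X' n) (ts_scale \<i> (Y' n))))) / 4))
      \<longlonglongrightarrow> complex_of_real ((0 - 0) / 4) - \<i> * complex_of_real ((0 - 0) / 4)"
    by (intro tendsto_intros Z assms iY) auto
  then have "(\<lambda>n. ts_form (X n) (Y n) - ts_form (X' n) (Y' n)) \<longlonglongrightarrow> 0"
    by (subst (1 2) ts_form_polarization) (simp add: algebra_simps diff_divide_distrib add_divide_distrib)
  moreover have "(\<lambda>n. ts_form (X n) (Y n) - ts_form (X' n) (Y' n)) \<longlonglongrightarrow>
      lim (\<lambda>n. ts_form (X n) (Y n)) - lim (\<lambda>n. ts_form (X' n) (Y' n))"
    using assms by (intro tendsto_diff ts_form_LIMSEQ) (auto simp: ts_equiv_def)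
  ultimately show ?thesis
    using LIMSEQ_unique by fastforce
qed

quotient_type (overloaded) ('a, 'b) htensor =
  "nat \<Rightarrow> ('a::complex_inner \<times> 'b::complex_inner) list" / partial: ts_equiv
proof (rule part_equivpI)
  show "\<exists>X :: nat \<Rightarrow> ('a \<times> 'b) list. ts_equiv X X"
    using ts_equiv_refl ts_Cauchy_const by blast
qed (auto intro: sympI transpI ts_equiv_sym ts_equiv_trans)

instantiation htensor :: (complex_inner, complex_inner) complex_inner
begin

lift_definition zero_htensor :: "('a, 'b) htensor" is "\<lambda>_. []"
  by (simp add: ts_equiv_refl)

lift_definition plus_htensor :: "('a, 'b) htensor \<Rightarrow> ('a, 'b) htensor \<Rightarrow> ('a, 'b) htensor"
  is "\<lambda>X Y n. X n @ Y n"
  by (rule ts_equiv_append)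

lift_definition scaleC_htensor :: "complex \<Rightarrow> ('a, 'b) htensor \<Rightarrow> ('a, 'b) htensor"
  is "\<lambda>c X n. ts_scale c (X n)"
  by (rule ts_equiv_scale)

lift_definition cinner_htensor :: "('a, 'b) htensor \<Rightarrow> ('a, 'b) htensor \<Rightarrow> complex"
  is "\<lambda>X Y. lim (\<lambda>n. ts_form (X n) (Y n))"
  by (rule ts_form_lim_cong)

definition uminus_htensor :: "('a, 'b) htensor \<Rightarrow> ('a, 'b) htensor" where
  "uminus_htensor x = (-1) *\<^sub>C x"

definition minus_htensor :: "('a, 'b) htensor \<Rightarrow> ('a, 'b) htensor \<Rightarrow> ('a, 'b) htensor" where
  "minus_htensor x y = x + - y"

definition scaleR_htensor :: "real \<Rightarrow> ('a, 'b) htensor \<Rightarrow> ('a, 'b) htensor" where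
  "scaleR_htensor r x = complex_of_real r *\<^sub>C x"

definition inner_htensor :: "('a, 'b) htensor \<Rightarrow> ('a, 'b) htensor \<Rightarrow> real" where
  "inner_htensor x y = Re \<langle>x, y\<rangle>"

definition norm_htensor :: "('a, 'b) htensor \<Rightarrow> real" where
  "norm_htensor x = sqrt (inner x x)"

definition dist_htensor :: "('a, 'b) htensor \<Rightarrow> ('a, 'b) htensor \<Rightarrow> real" where
  "dist_htensor x y = norm (x - y)"

definition sgn_htensor :: "('a, 'b) htensor \<Rightarrow> ('a, 'b) htensor" where
  "sgn_htensor x = inverse (norm x) *\<^sub>R x"

definition uniformity_htensor :: "(('a, 'b) htensor \<times> ('a, 'b) htensor) filter" where
  "uniformity_htensor = (INF e\<in>{0 <..}. principal {(x, y). dist x y < e})"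

definition open_htensor :: "('a, 'b) htensor set \<Rightarrow> bool" where
  "open_htensor U \<longleftrightarrow> (\<forall>x\<in>U. eventually (\<lambda>(x', y). x' = x \<longrightarrow> y \<in> U) uniformity)"

instance
proof
  fix x y z :: "('a, 'b) htensor" and a b :: complex and r s :: real
  note C = ts_Cauchy_append ts_Cauchy_scale ts_equiv_refl
  show "x + y + z = x + (y + z)"
    by transfer (auto intro!: ts_equivI C(1,2) simp: C(3))
  show "x + y = y + x"
    by transfer (auto intro!: ts_equivI C(1,2) simp: C(3))
  show "0 + x = x"
    by transfer (auto intro!: ts_equivI C(1,2) simp: C(3))
  show "- x + x = 0"
    unfolding uminus_htensor_def
    by transfer (auto intro!: ts_equivI C(1,2) simp: C(3))
  show "x - y = x + - y"
    by (simp add: minus_htensor_def)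
  show aR: "a *\<^sub>C (x + y) = a *\<^sub>C x + a *\<^sub>C y" for a and x y :: "('a, 'b) htensor"
    by transfer (auto intro!: ts_equivI C(1,2) simp: C(3) algebra_simps)
  show aL: "(a + b) *\<^sub>C x = a *\<^sub>C x + b *\<^sub>C x" for a b and x :: "('a, 'b) htensor"
    by transfer (auto intro!: ts_equivI C(1,2) simp: C(3) algebra_simps)
  show sc: "a *\<^sub>C b *\<^sub>C x = (a * b) *\<^sub>C x" for a b and x :: "('a, 'b) htensor"
    by transfer (auto intro!: ts_equivI C(1,2) simp: C(3) algebra_simps)
  show "complex_of_real r *\<^sub>C x = r *\<^sub>R x"
    by (simp add: scaleR_htensor_def)
  show "r *\<^sub>R (x + y) = r *\<^sub>R x + r *\<^sub>R y"
    by (simp add: scaleR_htensor_def aR)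
  show "(r + s) *\<^sub>R x = r *\<^sub>R x + s *\<^sub>R x"
    by (simp add: scaleR_htensor_def aL)
  show "r *\<^sub>R s *\<^sub>R x = (r * s) *\<^sub>R x"
    by (simp add: scaleR_htensor_def sc)
  show "1 *\<^sub>R x = x"
    unfolding scaleR_htensor_def
    by transfer (auto intro!: ts_equivI C(1,2) simp: C(3))
  show comm: "\<langle>x, y\<rangle> = cnj \<langle>y, x\<rangle>" for x y :: "('a, 'b) htensor"
  proof transfer
    fix X Y :: "nat \<Rightarrow> ('a \<times> 'b) list"
    assume "ts_equiv X X" "ts_equiv Y Y"
    then have "(\<lambda>n. cnj (ts_form (Y n) (X n))) \<longlonglongrightarrow> cnj (lim (\<lambda>n. ts_form (Y n) (X n)))"
      by (intro tendsto_cnj ts_form_LIMSEQ) (auto simp: C)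
    then show "lim (\<lambda>n. ts_form (X n) (Y n)) = cnj (lim (\<lambda>n. ts_form (Y n) (X n)))"
      by (subst ts_form_commute) (rule limI)
  qed
  show add: "\<langle>x, y + z\<rangle> = \<langle>x, y\<rangle> + \<langle>x, z\<rangle>" for x y z :: "('a, 'b) htensor"
  proof transfer
    fix X Y Z :: "nat \<Rightarrow> ('a \<times> 'b) list"
    assume "ts_equiv X X" "ts_equiv Y Y" "ts_equiv Z Z"
    then have "(\<lambda>n. ts_form (X n) (Y n) + ts_form (X n) (Z n)) \<longlonglongrightarrow>
        lim (\<lambda>n. ts_form (X n) (Y n)) + lim (\<lambda>n. ts_form (X n) (Z n))"
      by (intro tendsto_add ts_form_LIMSEQ) (auto simp: C)
    then show "lim (\<lambda>n. ts_form (X n) (Y n @ Z n)) =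
        lim (\<lambda>n. ts_form (X n) (Y n)) + lim (\<lambda>n. ts_form (X n) (Z n))"
      by (simp add: limI)
  qed
  show scr: "\<langle>x, a *\<^sub>C y\<rangle> = a * \<langle>x, y\<rangle>" for a and x y :: "('a, 'b) htensor"
  proof transfer
    fix a and X Y :: "nat \<Rightarrow> ('a \<times> 'b) list"
    assume "ts_equiv X X" "ts_equiv Y Y"
    then have "(\<lambda>n. a * ts_form (X n) (Y n)) \<longlonglongrightarrow> a * lim (\<lambda>n. ts_form (X n) (Y n))"
      by (intro tendsto_mult_left ts_form_LIMSEQ) (auto simp: C)
    then show "lim (\<lambda>n. ts_form (X n) (ts_scale a (Y n))) = a * lim (\<lambda>n. ts_form (X n) (Y n))"
      by (simp add: limI)
  qed
  show "Re \<langle>x, y\<rangle> = inner x y"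
    by (simp add: inner_htensor_def)
  show ic: "inner x y = inner y x" for x y :: "('a, 'b) htensor"
    using comm [of x y] by (simp add: inner_htensor_def)
  show "inner (x + y) z = inner x z + inner y z"
    using add [of z x y] ic by (simp add: inner_htensor_def)
  show "inner (r *\<^sub>R x) y = r * inner x y"
    using scr [of y "of_real r" x] ic by (simp add: inner_htensor_def scaleR_htensor_def)
  have lim_sq: "(\<lambda>n. (ts_norm (X n))\<^sup>2) \<longlonglongrightarrow> Re (lim (\<lambda>n. ts_form (X n) (X n)))"
    if "ts_equiv X X" for X :: "nat \<Rightarrow> ('a \<times> 'b) list"
  proof -
    have "(\<lambda>n. Re (ts_form (X n) (X n))) \<longlonglongrightarrow> Re (lim (\<lambda>n. ts_form (X n) (X n)))"
      using that by (intro tendsto_Re ts_form_LIMSEQ) (auto simp: C)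
    then show ?thesis by (simp add: ts_form_self)
  qed
  show "0 \<le> inner x x"
    unfolding inner_htensor_def
    by transfer (rule LIMSEQ_le_const [OF lim_sq], auto)
  show "inner x x = 0 \<longleftrightarrow> x = 0"
    unfolding inner_htensor_def
  proof transfer
    fix X :: "nat \<Rightarrow> ('a \<times> 'b) list"
    assume X: "ts_equiv X X"
    have "ts_norm (ts_diff (X n) []) = ts_norm (X n)" for n
      by (rule ts_norm_cong) simp
    then have "ts_equiv X (\<lambda>_. []) \<longleftrightarrow> (\<lambda>n. ts_norm (X n)) \<longlonglongrightarrow> 0"
      using X by (simp add: ts_equiv_def)
    also have "\<dots> \<longleftrightarrow> (\<lambda>n. (ts_norm (X n))\<^sup>2) \<longlonglongrightarrow> 0"
      using tendsto_power [of "\<lambda>n. ts_norm (X n)" 0 sequentially 2]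
        tendsto_real_sqrt [of "\<lambda>n. (ts_norm (X n))\<^sup>2" 0] by auto
    also have "\<dots> \<longleftrightarrow> Re (lim (\<lambda>n. ts_form (X n) (X n))) = 0"
      using lim_sq [OF X] LIMSEQ_unique by metis
    finally show "Re (lim (\<lambda>n. ts_form (X n) (X n))) = 0 \<longleftrightarrow> ts_equiv X (\<lambda>_. [])"
      by simp
  qed
qed (simp_all add: norm_htensor_def dist_htensor_def sgn_htensor_def
    uniformity_htensor_def open_htensor_def)

end

lift_definition formal_sum :: "('a::complex_inner \<times> 'b::complex_inner) list \<Rightarrow> ('a, 'b) htensor"
  is "\<lambda>s _. s"
  by (simp add: ts_equiv_refl)

definition tensor_vec :: "'a::complex_inner \<Rightarrow> 'b::complex_inner \<Rightarrow> ('a, 'b) htensor"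
    (infixr \<open>\<otimes>\<^sub>v\<close> 70) where
  "x \<otimes>\<^sub>v y = formal_sum [(x, y)]"

lemma cinner_formal_sum: "\<langle>formal_sum s, formal_sum t\<rangle> = ts_form s t"
  by transfer simp

lemma norm_htensor_LIMSEQ:
  assumes "ts_Cauchy X"
  shows "(\<lambda>n. ts_norm (X n)) \<longlonglongrightarrow> norm (abs_htensor X)"
proof -
  have "\<langle>abs_htensor X, abs_htensor X\<rangle> = lim (\<lambda>n. ts_form (X n) (X n))"
    using assms by (simp add: cinner_htensor.abs_eq ts_equiv_refl)
  then have "(\<lambda>n. sqrt (Re (ts_form (X n) (X n)))) \<longlonglongrightarrow> norm (abs_htensor X)"
    unfolding norm_htensor_def inner_htensor_def
    using assms by (intro tendsto_real_sqrt tendsto_Re) (metis ts_form_LIMSEQ)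
  then show ?thesis
    by (simp add: ts_norm_def)
qed

lemma diff_htensor_abs:
  assumes "ts_Cauchy X" "ts_Cauchy Y"
  shows "abs_htensor X - abs_htensor Y = abs_htensor (\<lambda>n. ts_diff (X n) (Y n))"
  using assms by (simp add: minus_htensor_def uminus_htensor_def scaleC_htensor.abs_eq
      plus_htensor.abs_eq ts_equiv_refl ts_Cauchy_scale ts_diff_def del: scaleC_minus1)

lemma formal_sum_abs: "formal_sum s = abs_htensor (\<lambda>_. s)"
  by (simp add: formal_sum.abs_eq)

lemma dist_formal_sum: "dist (formal_sum s) (formal_sum t) = ts_norm (ts_diff s t)"
proof -
  have "(\<lambda>_::nat. ts_norm (ts_diff s t)) \<longlonglongrightarrow> norm (abs_htensor (\<lambda>_. ts_diff s t))"
    by (rule norm_htensor_LIMSEQ) simp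
  then show ?thesis
    by (simp add: dist_htensor_def formal_sum_abs diff_htensor_abs LIMSEQ_const_iff)
qed

lemma formal_sum_LIMSEQ:
  assumes "ts_Cauchy X"
  shows "(\<lambda>n. formal_sum (X n)) \<longlonglongrightarrow> abs_htensor X"
proof (rule LIMSEQ_I)
  fix e :: real assume e: "e > 0"
  then obtain N where N: "\<And>m n. m \<ge> N \<Longrightarrow> n \<ge> N \<Longrightarrow> ts_norm (ts_diff (X m) (X n)) < e / 2"
    using assms unfolding ts_Cauchy_def by (meson half_gt_zero)
  have "norm (formal_sum (X m) - abs_htensor X) < e" if "m \<ge> N" for m
  proof -
    have "(\<lambda>n. ts_norm (ts_diff (X m) (X n))) \<longlonglongrightarrow> norm (abs_htensor (\<lambda>n. ts_diff (X m) (X n)))"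
      by (intro norm_htensor_LIMSEQ ts_Cauchy_diff assms ts_Cauchy_const)
    then have "norm (abs_htensor (\<lambda>n. ts_diff (X m) (X n))) \<le> e / 2"
      by (rule LIMSEQ_le_const2) (use N that in \<open>auto intro: less_imp_le\<close>)
    then show ?thesis
      using e assms by (simp add: formal_sum_abs diff_htensor_abs)
  qed
  then show "\<exists>N. \<forall>m\<ge>N. norm (formal_sum (X m) - abs_htensor X) < e"
    by blast
qed

lemma htensor_approx: "\<exists>X. ts_Cauchy X \<and> (\<lambda>n. formal_sum (X n)) \<longlonglongrightarrow> x"
proof -
  have "x = abs_htensor (rep_htensor x)" "ts_Cauchy (rep_htensor x)"
    using Quotient3_abs_rep [OF Quotient3_htensor] Quotient3_rep_reflp [OF Quotient3_htensor]
    by (metis, metis ts_equiv_refl)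
  then show ?thesis
    using formal_sum_LIMSEQ by metis
qed

instance htensor :: (complex_inner, complex_inner) chilbert_space
proof
  fix F :: "nat \<Rightarrow> ('a, 'b) htensor"
  assume F: "Cauchy F"
  have "\<exists>s. dist (formal_sum s) (F k) < 1 / real (Suc k)" for k
  proof -
    obtain X where "(\<lambda>n. formal_sum (X n)) \<longlonglongrightarrow> F k"
      using htensor_approx by blast
    then have "eventually (\<lambda>n. dist (formal_sum (X n)) (F k) < 1 / real (Suc k)) sequentially"
      by (rule tendstoD) simp
    then show ?thesis
      by (auto dest: eventually_happens)
  qed
  then obtain S where S: "\<And>k. dist (formal_sum (S k)) (F k) < 1 / real (Suc k)"
    by metis
  have lim: "(\<lambda>k. formal_sum (S k) - F k) \<longlonglongrightarrow> 0"
    using LIMSEQ_inverse_real_of_nat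
    by (rule tendsto_0_le [where K = 1])
       (use S in \<open>auto simp: dist_norm inverse_eq_divide intro!: always_eventually less_imp_le\<close>)
  have "ts_Cauchy S"
    unfolding ts_Cauchy_def dist_formal_sum [symmetric]
  proof (intro allI impI)
    fix e :: real assume "e > 0"
    then have e: "e / 3 > 0" by simp
    obtain M where M: "\<And>m n. m \<ge> M \<Longrightarrow> n \<ge> M \<Longrightarrow> dist (F m) (F n) < e / 3"
      using F e unfolding Cauchy_def by blast
    obtain N where N: "\<And>n. n \<ge> N \<Longrightarrow> dist (formal_sum (S n)) (F n) < e / 3"
      using LIMSEQ_D [OF lim e] by (auto simp: dist_norm)
    have "dist (formal_sum (S m)) (formal_sum (S n)) < e" if "m \<ge> max M N" "n \<ge> max M N" for m n
    proof -
      have "dist (formal_sum (S m)) (formal_sum (S n))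
          \<le> dist (formal_sum (S m)) (F m) + dist (F m) (F n) + dist (formal_sum (S n)) (F n)"
        by metric
      then show ?thesis
        using M [of m n] N [of m] N [of n] that by simp
    qed
    then show "\<exists>N. \<forall>m\<ge>N. \<forall>n\<ge>N. dist (formal_sum (S m)) (formal_sum (S n)) < e"
      by blast
  qed
  then have "(\<lambda>k. formal_sum (S k) - (formal_sum (S k) - F k)) \<longlonglongrightarrow> abs_htensor S - 0"
    by (intro tendsto_diff lim formal_sum_LIMSEQ)
  then show "convergent F"
    by (auto simp: convergent_def)
qed

lemma cinner_tensor_vec: "\<langle>u \<otimes>\<^sub>v v, x \<otimes>\<^sub>v y\<rangle> = \<langle>u, x\<rangle> * \<langle>v, y\<rangle>"
  by (simp add: tensor_vec_def cinner_formal_sum ts_form_single)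

lemma formal_sum_eq: "formal_sum s = (\<Sum>(x, y)\<leftarrow>s. x \<otimes>\<^sub>v y)"
proof (induction s)
  case Nil
  show ?case by (simp add: zero_htensor_def formal_sum_abs)
next
  case (Cons p s)
  have "formal_sum (p # s) = formal_sum [p] + formal_sum s"
    by (simp add: formal_sum_abs plus_htensor.abs_eq ts_equiv_refl)
  with Cons show ?case
    by (cases p) (simp add: tensor_vec_def)
qed

lemma closure_span_tensor_vec:
  "closure (span (range (\<lambda>(x, y). x \<otimes>\<^sub>v y))) = (UNIV :: ('a::complex_inner, 'b::complex_inner) htensor set)"
proof -
  have "formal_sum s \<in> span (range (\<lambda>(x, y). x \<otimes>\<^sub>v y))" for s :: "('a \<times> 'b) list"
    unfolding formal_sum_eq
    by (induction s) (auto intro!: span_zero span_add intro: span_base)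
  moreover have "\<exists>X. (\<lambda>n. formal_sum (X n)) \<longlonglongrightarrow> x" for x :: "('a, 'b) htensor"
    using htensor_approx [of x] by blast
  ultimately have "x \<in> closure (span (range (\<lambda>(x, y). x \<otimes>\<^sub>v y)))" for x :: "('a, 'b) htensor"
    unfolding closure_sequential by meson
  then show ?thesis by blast
qed


section \<open>Operators\<close>

text \<open>Bounded operators on a complex Hilbert space are the elements of the library type of bounded
  real-linear maps that commute with complex scalars.\<close>

definition clinear_op :: "('a::complex_inner \<Rightarrow>\<^sub>L 'b::complex_inner) \<Rightarrow> bool" where
  "clinear_op A \<longleftrightarrow> (\<forall>c x. blinfun_apply A (c *\<^sub>C x) = c *\<^sub>C blinfun_apply A x)"

definition invertible_op :: "('a::complex_inner \<Rightarrow>\<^sub>L 'a) \<Rightarrow> bool" where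
  "invertible_op A \<longleftrightarrow>
    (\<exists>B. clinear_op B \<and> A o\<^sub>L B = id_blinfun \<and> B o\<^sub>L A = id_blinfun)"

definition positive_op :: "('a::complex_inner \<Rightarrow>\<^sub>L 'a) \<Rightarrow> bool" where
  "positive_op A \<longleftrightarrow> clinear_op A \<and> (\<forall>x. \<langle>x, blinfun_apply A x\<rangle> \<in> \<real>\<^sub>\<ge>\<^sub>0)"

definition strictly_positive_op :: "('a::complex_inner \<Rightarrow>\<^sub>L 'a) \<Rightarrow> bool" where
  "strictly_positive_op A \<longleftrightarrow> positive_op A \<and> invertible_op A"

text \<open>\<open>A \<otimes> B\<close> is the unique bounded operator that maps each \<open>x \<otimes> y\<close> to \<open>A x \<otimes> B y\<close>.\<close>

definition tensor_op :: "('a::complex_inner \<Rightarrow>\<^sub>L 'a) \<Rightarrow> ('b::complex_inner \<Rightarrow>\<^sub>L 'b) \<Rightarrow>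
    (('a, 'b) htensor \<Rightarrow>\<^sub>L ('a, 'b) htensor)"  (infixr \<open>\<otimes>\<^sub>o\<close> 70) where
  "A \<otimes>\<^sub>o B = (THE T. clinear_op T \<and>
     (\<forall>x y. blinfun_apply T (x \<otimes>\<^sub>v y) = blinfun_apply A x \<otimes>\<^sub>v blinfun_apply B y))"


section \<open>Continuous functional calculus\<close>

definition spectrum_op :: "('a::complex_inner \<Rightarrow>\<^sub>L 'a) \<Rightarrow> complex set" where
  "spectrum_op A = {z. \<not> invertible_op (A - Blinfun (\<lambda>x. z *\<^sub>C x))}"

definition poly_op :: "real poly \<Rightarrow> ('a::complex_inner \<Rightarrow>\<^sub>L 'a) \<Rightarrow> ('a \<Rightarrow>\<^sub>L 'a)" where
  "poly_op p A = (\<Sum>k\<le>degree p. coeff p k *\<^sub>R (((o\<^sub>L) A ^^ k) id_blinfun))"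

text \<open>For a self-adjoint operator \<open>A\<close>, whose spectrum is real, and a real function \<open>f\<close> continuous on
  the spectrum, \<open>f(A)\<close> is the norm limit of \<open>p\<^sub>n(A)\<close> for any polynomials \<open>p\<^sub>n\<close> converging to \<open>f\<close>
  uniformly on the spectrum.\<close>

definition cfun_op :: "(real \<Rightarrow> real) \<Rightarrow> ('a::complex_inner \<Rightarrow>\<^sub>L 'a) \<Rightarrow> ('a \<Rightarrow>\<^sub>L 'a)" where
  "cfun_op f A = (THE T. \<exists>p :: nat \<Rightarrow> real poly.
     uniform_limit {x. complex_of_real x \<in> spectrum_op A} (\<lambda>n x. poly (p n) x) f sequentially \<and>
     (\<lambda>n. poly_op (p n) A) \<longlonglongrightarrow> T)"

definition powr_op :: "('a::complex_inner \<Rightarrow>\<^sub>L 'a) \<Rightarrow> real \<Rightarrow> ('a \<Rightarrow>\<^sub>L 'a)" where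
  "powr_op A t = cfun_op (\<lambda>x. x powr t) A"


section \<open>Tsallis relative operator entropy\<close>

definition tsallis_entropy :: "real \<Rightarrow> ('a::chilbert_space \<Rightarrow>\<^sub>L 'a) \<Rightarrow> ('a \<Rightarrow>\<^sub>L 'a) \<Rightarrow> ('a \<Rightarrow>\<^sub>L 'a)" where
  "tsallis_entropy lam A B = (1 / lam) *\<^sub>R
     ((powr_op A (1/2)
         o\<^sub>L powr_op (powr_op A (-1/2) o\<^sub>L B o\<^sub>L powr_op A (-1/2)) lam
         o\<^sub>L powr_op A (1/2)) - A)"

end

theory Submission
  imports Defs "HOL-Computational_Algebra.Fundamental_Theorem_Algebra"
begin

text \<open>Writing \<open>A #\<^sub>t B\<close> for the weighted geometric mean \<open>A\<^sup>1\<^sup>/\<^sup>2 (A\<^sup>-\<^sup>1\<^sup>/\<^sup>2 B A\<^sup>-\<^sup>1\<^sup>/\<^sup>2)\<^sup>t A\<^sup>1\<^sup>/\<^sup>2\<close>, we have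
  \<open>A #\<^sub>t B = A + t T\<^sub>t(A|B)\<close>, so the identity is the expansion of
  \<open>(A\<^sub>1 \<otimes> A\<^sub>2) #\<^sub>t (B\<^sub>1 \<otimes> B\<^sub>2) = (A\<^sub>1 #\<^sub>t B\<^sub>1) \<otimes> (A\<^sub>2 #\<^sub>t B\<^sub>2)\<close>.  That equation reduces to
  \<open>(A \<otimes> B)\<^sup>t = A\<^sup>t \<otimes> B\<^sup>t\<close>, which holds because a continuous one-parameter group \<open>E\<close> of self-adjoint
  operators is determined by \<open>E(1)\<close>.  The functional calculus behind the powers rests on the bound of
  \<open>\<parallel>p(A)\<parallel>\<close> by the maximum of \<open>|p|\<close> on the spectrum, for real polynomials \<open>p\<close> and self-adjoint \<open>A\<close>.\<close>

section \<open>Operators on a complex Hilbert space\<close>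

text \<open>The powers are definite descriptions over real polynomials converging on the spectrum,
  so nothing can be said about them before the limit is known to exist and not to depend on the
  polynomials; the norm bound gives both. It is obtained without a spectral radius formula: a
  nonzero real polynomial with no zero on the spectrum splits into real linear and irreducible
  quadratic factors, and each of them is bounded below at a self-adjoint operator. The spectrum of a
  tensor product is never computed. A power of a tensor product is instead recognised through the
  group law: E(1/n) is a positive n-th root of E(1), and the functional calculus of E(1/n) itself
  shows that this root is the power with exponent 1/n. The types of Hilbert spaces include the zero
  space, where spectra are empty and even the identity has norm 0; several constants are chosen to
  stay positive there.\<close>

lemma clinear_op_scaleC: "clinear_op A \<Longrightarrow> blinfun_apply A (c *\<^sub>C x) = c *\<^sub>C blinfun_apply A x"
  by (simp add: clinear_op_def)

lemma clinear_op_compose: "clinear_op A \<Longrightarrow> clinear_op B \<Longrightarrow> clinear_op (A o\<^sub>L B)"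
  by (simp add: clinear_op_def)

lemma clinear_op_add: "clinear_op A \<Longrightarrow> clinear_op B \<Longrightarrow> clinear_op (A + B)"
  by (simp add: clinear_op_def blinfun.add_left scaleC_add_right)

lemma scaleR_scaleC_commute: "r *\<^sub>R c *\<^sub>C x = c *\<^sub>C r *\<^sub>R (x :: 'a::complex_inner)"
  by (metis scaleC_of_real scaleC_scaleC mult.commute)

lemma clinear_op_scaleR: "clinear_op A \<Longrightarrow> clinear_op (r *\<^sub>R A)"
  by (simp add: clinear_op_def blinfun.scaleR_left scaleR_scaleC_commute)

lemma clinear_op_minus: "clinear_op A \<Longrightarrow> clinear_op (- A)"
  using clinear_op_scaleR [of A "-1"] by simp

lemma clinear_op_diff: "clinear_op A \<Longrightarrow> clinear_op B \<Longrightarrow> clinear_op (A - B)"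
  using clinear_op_add [of A "- B"] clinear_op_minus [of B] by simp

lemma clinear_op_id [simp]: "clinear_op id_blinfun"
  by (simp add: clinear_op_def)

lemma blinfun_compose_assoc: "(A o\<^sub>L B) o\<^sub>L C = A o\<^sub>L (B o\<^sub>L C)"
  by (rule blinfun_eqI) simp

lemma blinfun_compose_id [simp]: "A o\<^sub>L id_blinfun = A" "id_blinfun o\<^sub>L A = A"
  by (rule blinfun_eqI, simp)+

lemma Blinfun_scaleC_of_real:
  "Blinfun (\<lambda>x :: 'a::complex_inner. complex_of_real r *\<^sub>C x) = r *\<^sub>R id_blinfun"
proof (rule blinfun_eqI)
  fix x :: 'a
  show "blinfun_apply (Blinfun (\<lambda>x. complex_of_real r *\<^sub>C x)) x = blinfun_apply (r *\<^sub>R id_blinfun) x"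
    unfolding bounded_linear_Blinfun_apply [OF bounded_linear_scaleC]
    by (simp add: scaleC_of_real blinfun.scaleR_left)
qed

section \<open>Invertibility and lower bounds\<close>

lemma invertible_op_bounded_below:
  assumes "invertible_op A"
  obtains c where "c > 0" "\<And>x. c * norm x \<le> norm (blinfun_apply A x)"
proof -
  obtain B where B: "B o\<^sub>L A = id_blinfun"
    using assms by (auto simp: invertible_op_def)
  \<comment> \<open>The added 1 keeps the constant positive on the zero space, where
    \<open>norm B\<close> is 0.\<close>
  have "norm x \<le> (norm B + 1) * norm (blinfun_apply A x)" for x
  proof -
    have "norm x = norm (blinfun_apply B (blinfun_apply A x))"
      by (metis B blinfun_apply_blinfun_compose blinfun_apply_id_blinfun)
    also have "\<dots> \<le> norm B * norm (blinfun_apply A x)"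
      by (rule norm_blinfun)
    also have "\<dots> \<le> (norm B + 1) * norm (blinfun_apply A x)"
      by (intro mult_right_mono) auto
    finally show ?thesis .
  qed
  moreover have "norm B + 1 > 0"
    by (simp add: add_nonneg_pos)
  ultimately show ?thesis
    by (intro that [of "1 / (norm B + 1)"]) (simp_all add: pos_divide_le_eq mult.commute)
qed

text \<open>Lax--Milgram: for small \<open>c > 0\<close>, the solution of \<open>S x = y\<close> is the fixed point of the
  contraction \<open>x \<mapsto> x - c (S x - y)\<close>.\<close>

lemma coercive_invertible_op:
  fixes S :: "'a::chilbert_space \<Rightarrow>\<^sub>L 'a"
  assumes S: "clinear_op S" and a: "a > 0"
    and coercive: "\<And>x. a * (norm x)\<^sup>2 \<le> inner x (blinfun_apply S x)"
  shows "invertible_op S"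
proof -
  have below: "a * norm x \<le> norm (blinfun_apply S x)" for x
  proof (cases "x = 0")
    case False
    have "a * norm x * norm x \<le> norm (blinfun_apply S x) * norm x"
      using coercive [of x] norm_cauchy_schwarz [of x "blinfun_apply S x"]
      by (simp add: power2_eq_square mult_ac)
    then show ?thesis using False by simp
  qed simp
  define b where "b = norm S + a"
  have b: "b > 0" "norm S \<le> b" "a \<le> b" using a by (auto simp: b_def add_nonneg_pos)
  \<comment> \<open>This step size minimises 1 - 2 c a + c^2 b^2, the bound on the squared
    contraction factor. The minimum 1 - a^2 / b^2 is nonnegative because
    \<open>a \<le> b\<close>.\<close>
  define c where "c = a / b\<^sup>2"
  have c: "c > 0" using a b by (simp add: c_def)
  define k where "k = sqrt (1 - a\<^sup>2 / b\<^sup>2)"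
  have ab: "a\<^sup>2 / b\<^sup>2 \<le> 1" "0 < a\<^sup>2 / b\<^sup>2"
    using a b by (auto simp: power_mono)
  have contr: "norm (x - c *\<^sub>R blinfun_apply S x) \<le> k * norm x" for x
  proof (rule power2_le_imp_le)
    have "(norm (x - c *\<^sub>R blinfun_apply S x))\<^sup>2 =
        (norm x)\<^sup>2 - 2 * c * inner x (blinfun_apply S x) + c\<^sup>2 * (norm (blinfun_apply S x))\<^sup>2"
      unfolding power2_norm_eq_inner
      by (simp add: inner_diff_left inner_diff_right inner_commute power2_eq_square [of c]
          algebra_simps del: dot_square_norm)
    also have "\<dots> \<le> (norm x)\<^sup>2 - 2 * c * (a * (norm x)\<^sup>2) + c\<^sup>2 * (b * norm x)\<^sup>2"
    proof -
      have "norm (blinfun_apply S x) \<le> b * norm x"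
        using norm_blinfun [of S x] b by (meson mult_right_mono norm_ge_zero order_trans)
      then show ?thesis
        using coercive [of x] c by (intro add_mono diff_mono mult_left_mono power_mono) auto
    qed
    also have "\<dots> = (1 - a\<^sup>2 / b\<^sup>2) * (norm x)\<^sup>2"
      using b by (simp add: c_def field_simps power2_eq_square)
    finally show "(norm (x - c *\<^sub>R blinfun_apply S x))\<^sup>2 \<le> (k * norm x)\<^sup>2"
      using ab by (simp add: k_def power_mult_distrib)
  qed (use ab in \<open>simp add: k_def\<close>)
  have "\<exists>x. blinfun_apply S x = y" for y
  proof -
    have "\<exists>!x. x - c *\<^sub>R (blinfun_apply S x - y) = x"
    proof (rule banach_fix_type [of k])
      show "\<forall>x z. dist (x - c *\<^sub>R (blinfun_apply S x - y)) (z - c *\<^sub>R (blinfun_apply S z - y)) \<le> k * dist x z"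
      proof (intro allI)
        fix x z
        have eq: "x - c *\<^sub>R (blinfun_apply S x - y) - (z - c *\<^sub>R (blinfun_apply S z - y)) =
            (x - z) - c *\<^sub>R blinfun_apply S (x - z)"
          by (simp add: algebra_simps blinfun.diff_right)
        then show "dist (x - c *\<^sub>R (blinfun_apply S x - y)) (z - c *\<^sub>R (blinfun_apply S z - y)) \<le> k * dist x z"
          using contr [of "x - z"] unfolding dist_norm eq by simp
      qed
    qed (use ab in \<open>auto simp: k_def\<close>)
    then show ?thesis using c by auto
  qed
  then obtain g where g: "\<And>y. blinfun_apply S (g y) = y" by metis
  have inj: "x = z" if "blinfun_apply S x = blinfun_apply S z" for x z
    using below [of "x - z"] that a by (simp add: blinfun.diff_right mult_le_0_iff)
  have bl: "bounded_linear g"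
  proof (rule bounded_linear_intro [where K = "1 / a"])
    show "g (x + y) = g x + g y" for x y
      by (rule inj) (simp add: g blinfun.add_right)
    show "g (r *\<^sub>R x) = r *\<^sub>R g x" for r x
      by (rule inj) (simp add: g blinfun.scaleR_right)
    show "norm (g x) \<le> norm x * (1 / a)" for x
      using below [of "g x"] a by (simp add: g field_simps)
  qed
  show ?thesis
    unfolding invertible_op_def
  proof (intro exI conjI)
    show "clinear_op (Blinfun g)"
      unfolding clinear_op_def bounded_linear_Blinfun_apply [OF bl]
      by (intro allI, rule inj) (simp add: g clinear_op_scaleC [OF S])
    show "S o\<^sub>L Blinfun g = id_blinfun"
      by (rule blinfun_eqI) (simp add: bounded_linear_Blinfun_apply [OF bl] g)
    show "Blinfun g o\<^sub>L S = id_blinfun"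
      by (rule blinfun_eqI, rule inj) (simp add: bounded_linear_Blinfun_apply [OF bl] g)
  qed
qed

lemma invertible_op_minus:
  assumes "invertible_op A"
  shows "invertible_op (- A)"
proof -
  obtain B where "clinear_op B" "A o\<^sub>L B = id_blinfun" "B o\<^sub>L A = id_blinfun"
    using assms by (auto simp: invertible_op_def)
  then show ?thesis
    unfolding invertible_op_def
    by (intro exI [of _ "- B"])
      (simp add: clinear_op_minus bounded_bilinear.minus_left [OF bounded_bilinear_blinfun_compose]
        bounded_bilinear.minus_right [OF bounded_bilinear_blinfun_compose])
qed


section \<open>Self-adjoint operators\<close>

definition selfadjoint_op :: "('a::complex_inner \<Rightarrow>\<^sub>L 'a) \<Rightarrow> bool" where
  "selfadjoint_op A \<longleftrightarrow> clinear_op A \<and>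
    (\<forall>x y. \<langle>blinfun_apply A x, y\<rangle> = \<langle>x, blinfun_apply A y\<rangle>)"

lemma selfadjoint_op_clinear: "selfadjoint_op A \<Longrightarrow> clinear_op A"
  by (simp add: selfadjoint_op_def)

lemma selfadjoint_op_cinner:
  "selfadjoint_op A \<Longrightarrow> \<langle>blinfun_apply A x, y\<rangle> = \<langle>x, blinfun_apply A y\<rangle>"
  by (simp add: selfadjoint_op_def)

lemma selfadjoint_op_inner:
  "selfadjoint_op A \<Longrightarrow> inner (blinfun_apply A x) y = inner x (blinfun_apply A y)"
  by (metis Re_cinner selfadjoint_op_cinner)

lemma selfadjoint_op_id [simp]: "selfadjoint_op id_blinfun"
  by (simp add: selfadjoint_op_def)

lemma cinner_scaleR_right: "\<langle>x, r *\<^sub>R y\<rangle> = complex_of_real r * \<langle>x, y\<rangle>"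
  by (metis scaleC_of_real cinner_scaleC_right)

lemma cinner_scaleR_left: "\<langle>r *\<^sub>R x, y\<rangle> = complex_of_real r * \<langle>x, y\<rangle>"
  by (metis scaleC_of_real cinner_scaleC_left complex_cnj_complex_of_real)

lemma selfadjoint_op_add:
  "selfadjoint_op A \<Longrightarrow> selfadjoint_op B \<Longrightarrow> selfadjoint_op (A + B)"
  by (simp add: selfadjoint_op_def clinear_op_add blinfun.add_left cinner_add_left cinner_add_right)

lemma selfadjoint_op_scaleR: "selfadjoint_op A \<Longrightarrow> selfadjoint_op (r *\<^sub>R A)"
  by (simp add: selfadjoint_op_def clinear_op_scaleR blinfun.scaleR_left cinner_scaleR_left
      cinner_scaleR_right)

lemma selfadjoint_op_compose_commute:
  assumes "selfadjoint_op A" "selfadjoint_op B" "A o\<^sub>L B = B o\<^sub>L A"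
  shows "selfadjoint_op (A o\<^sub>L B)"
  using assms by (metis selfadjoint_op_def clinear_op_compose blinfun_apply_blinfun_compose)

text \<open>Cauchy-Schwarz for the real inner product also covers the imaginary part, since Im <x,
  y> is the real inner product of i x with y. The factor 2 adds the two parts.\<close>

lemma bounded_linear_cinner_right: "bounded_linear (\<lambda>y. \<langle>x, y\<rangle>)"
proof (rule bounded_linear_intro [where K = "2 * norm x"])
  fix y
  have "Im \<langle>x, y\<rangle> = inner (\<i> *\<^sub>C x) y"
    by (simp add: Re_cinner [symmetric])
  then have "\<bar>Im \<langle>x, y\<rangle>\<bar> \<le> norm x * norm y"
    using Cauchy_Schwarz_ineq2 [of "\<i> *\<^sub>C x" y] by (simp add: norm_scaleC)
  moreover have "\<bar>Re \<langle>x, y\<rangle>\<bar> \<le> norm x * norm y"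
    using Cauchy_Schwarz_ineq2 [of x y] by (simp add: Re_cinner)
  ultimately show "norm \<langle>x, y\<rangle> \<le> norm y * (2 * norm x)"
    using cmod_le [of "\<langle>x, y\<rangle>"] by (simp add: mult_ac)
qed (simp_all add: cinner_add_right cinner_scaleR_right scaleR_conv_of_real)

lemma tendsto_cinner_right: "(f \<longlongrightarrow> y) F \<Longrightarrow> ((\<lambda>n. \<langle>x, f n\<rangle>) \<longlongrightarrow> \<langle>x, y\<rangle>) F"
  by (rule bounded_linear.tendsto [OF bounded_linear_cinner_right])

lemma tendsto_cinner_left:
  assumes "(f \<longlongrightarrow> y) F"
  shows "((\<lambda>n. \<langle>f n, x\<rangle>) \<longlongrightarrow> \<langle>y, x\<rangle>) F"
proof -
  have "\<langle>y, x\<rangle> = cnj \<langle>x, y\<rangle>" "(\<lambda>n. \<langle>f n, x\<rangle>) = (\<lambda>n. cnj \<langle>x, f n\<rangle>)"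
    by (intro ext cinner_commute)+
  then show ?thesis
    using tendsto_cnj [OF tendsto_cinner_right [OF assms]] by simp
qed

lemma tendsto_blinfun_apply_left:
  "(A \<longlongrightarrow> T) F \<Longrightarrow> ((\<lambda>n. blinfun_apply (A n) x) \<longlongrightarrow> blinfun_apply T x) F"
  by (intro blinfun.tendsto tendsto_const)

lemma selfadjoint_op_limit:
  assumes "\<And>n. selfadjoint_op (A n)" "A \<longlonglongrightarrow> T"
  shows "selfadjoint_op T"
  unfolding selfadjoint_op_def clinear_op_def
proof (intro conjI allI)
  note lim = tendsto_blinfun_apply_left [OF assms(2)]
  show "blinfun_apply T (c *\<^sub>C x) = c *\<^sub>C blinfun_apply T x" for c x
  proof (rule LIMSEQ_unique [OF lim])
    show "(\<lambda>n. blinfun_apply (A n) (c *\<^sub>C x)) \<longlonglongrightarrow> c *\<^sub>C blinfun_apply T x"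
      using bounded_linear.tendsto [OF bounded_linear_scaleC lim]
      by (simp add: clinear_op_scaleC [OF selfadjoint_op_clinear [OF assms(1)]])
  qed
  show "\<langle>blinfun_apply T x, y\<rangle> = \<langle>x, blinfun_apply T y\<rangle>" for x y
    using tendsto_cinner_left [OF lim, of x y] tendsto_cinner_right [OF lim, of x y]
    by (simp add: selfadjoint_op_cinner [OF assms(1)] LIMSEQ_unique)
qed

text \<open>Polarization: the quadratic form is real at x + y, which relates the imaginary parts of
  <x, A y> and <y, A x>; replacing y by i y turns this into a relation of the real parts.\<close>

lemma positive_op_selfadjoint:
  fixes A :: "'a::complex_inner \<Rightarrow>\<^sub>L 'a"
  assumes "positive_op A"
  shows "selfadjoint_op A"
  unfolding selfadjoint_op_def
proof (intro conjI allI)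
  show A: "clinear_op A" using assms by (simp add: positive_op_def)
  have im: "Im \<langle>x, blinfun_apply A x\<rangle> = 0" for x
    using assms by (auto simp: positive_op_def complex_nonneg_Reals_iff)
  have 1: "Im \<langle>x, blinfun_apply A y\<rangle> = - Im \<langle>y, blinfun_apply A x\<rangle>" for x y
    using im [of "x + y"] im [of x] im [of y]
    by (simp add: blinfun.add_right cinner_add_left cinner_add_right)
  fix x y
  have "Re \<langle>x, blinfun_apply A y\<rangle> = Re \<langle>y, blinfun_apply A x\<rangle>"
    using 1 [of x "\<i> *\<^sub>C y"] by (simp add: clinear_op_scaleC [OF A])
  then have "\<langle>x, blinfun_apply A y\<rangle> = cnj \<langle>y, blinfun_apply A x\<rangle>"
    using 1 [of x y] by (simp add: complex_eq_iff)
  then show "\<langle>blinfun_apply A x, y\<rangle> = \<langle>x, blinfun_apply A y\<rangle>"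
    by (subst cinner_commute) simp
qed

text \<open>Bounds on the quadratic form stand in for the spectrum: they confine it to {a..b} by
  \<open>real_spectrum_between\<close>, and on such an interval Weierstrass approximation applies.
  With 0 < a, powers are continuous there.\<close>

definition op_between :: "real \<Rightarrow> real \<Rightarrow> ('a::complex_inner \<Rightarrow>\<^sub>L 'a) \<Rightarrow> bool" where
  "op_between a b A \<longleftrightarrow> selfadjoint_op A \<and>
    (\<forall>x. a * (norm x)\<^sup>2 \<le> inner x (blinfun_apply A x) \<and> inner x (blinfun_apply A x) \<le> b * (norm x)\<^sup>2)"

lemma inner_blinfun_le_norm: "inner x (blinfun_apply A x) \<le> norm A * (norm x)\<^sup>2"
proof -
  have "inner x (blinfun_apply A x) \<le> norm x * (norm A * norm x)"
    by (meson norm_cauchy_schwarz norm_blinfun mult_left_mono norm_ge_zero order_trans)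
  then show ?thesis by (simp add: power2_eq_square mult_ac)
qed

text \<open>The lower bound comes from positivity of \<open>A\<close> at \<open>x - t A x\<close> with \<open>t = 1 / (\<parallel>A\<parallel> + 1)\<close>.\<close>

lemma strictly_positive_op_between:
  fixes A :: "'a::complex_inner \<Rightarrow>\<^sub>L 'a"
  assumes "strictly_positive_op A"
  obtains a b where "0 < a" "a \<le> b" "op_between a b A"
proof -
  have A: "positive_op A" "invertible_op A"
    using assms by (auto simp: strictly_positive_op_def)
  have sa: "selfadjoint_op A" using A positive_op_selfadjoint by blast
  have pos: "0 \<le> inner x (blinfun_apply A x)" for x
    using A(1) by (auto simp: positive_op_def complex_nonneg_Reals_iff Re_cinner)
  obtain c where c: "c > 0" "\<And>x. c * norm x \<le> norm (blinfun_apply A x)"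
    using invertible_op_bounded_below [OF A(2)] by metis
  define m where "m = norm A + 1"
  have m: "m > 0" by (simp add: m_def add_nonneg_pos)
  have low: "c\<^sup>2 / m * (norm x)\<^sup>2 \<le> inner x (blinfun_apply A x)" for x
  proof -
    let ?y = "blinfun_apply A x"
    have "0 \<le> inner (x - (1 / m) *\<^sub>R ?y) (blinfun_apply A (x - (1 / m) *\<^sub>R ?y))"
      by (rule pos)
    also have "\<dots> = inner x ?y - 2 / m * (norm ?y)\<^sup>2 + (1 / m)\<^sup>2 * inner ?y (blinfun_apply A ?y)"
      using selfadjoint_op_inner [OF sa, of x ?y]
      unfolding power2_norm_eq_inner
      by (simp add: blinfun.diff_right blinfun.scaleR_right inner_diff_left inner_diff_right
          power2_eq_square [of "1 / m"] diff_divide_distrib del: dot_square_norm)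
    also have "\<dots> \<le> inner x ?y - 2 / m * (norm ?y)\<^sup>2 + (1 / m)\<^sup>2 * (m * (norm ?y)\<^sup>2)"
      using inner_blinfun_le_norm [of ?y A] mult_right_mono [of "norm A" m "(norm ?y)\<^sup>2"]
      by (intro add_left_mono mult_left_mono) (auto simp: m_def)
    also have "\<dots> = inner x ?y - (norm ?y)\<^sup>2 / m"
      using m by (simp add: field_simps power2_eq_square)
    finally have "(norm ?y)\<^sup>2 / m \<le> inner x ?y" by simp
    moreover have "(c * norm x)\<^sup>2 / m \<le> (norm ?y)\<^sup>2 / m"
      using c m by (intro divide_right_mono power_mono) auto
    ultimately show ?thesis by (simp add: power_mult_distrib)
  qed
  show ?thesis
  proof (rule that)
    show "0 < c\<^sup>2 / m" using c m by simp
    \<comment> \<open>On the zero space \<open>norm A\<close> is 0 and lies below the lower bound;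
      the maximum keeps the interval nonempty.\<close>
    show "c\<^sup>2 / m \<le> max (c\<^sup>2 / m) (norm A)" by simp
    have "inner x (blinfun_apply A x) \<le> max (c\<^sup>2 / m) (norm A) * (norm x)\<^sup>2" for x
      using inner_blinfun_le_norm [of x A] by (rule order_trans) (simp add: mult_right_mono)
    then show "op_between (c\<^sup>2 / m) (max (c\<^sup>2 / m) (norm A)) A"
      using low sa by (simp add: op_between_def)
  qed
qed

lemma selfadjoint_op_positiveI:
  assumes "selfadjoint_op A" "\<And>x. 0 \<le> inner x (blinfun_apply A x)"
  shows "positive_op A"
  unfolding positive_op_def
proof (intro conjI allI)
  show "clinear_op A" using assms by (simp add: selfadjoint_op_clinear)
  fix x
  have "Im \<langle>x, blinfun_apply A x\<rangle> = - Im \<langle>x, blinfun_apply A x\<rangle>"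
    using arg_cong [OF cinner_commute [of x "blinfun_apply A x"], of Im]
      selfadjoint_op_cinner [OF assms(1), of x x] by simp
  then show "\<langle>x, blinfun_apply A x\<rangle> \<in> \<real>\<^sub>\<ge>\<^sub>0"
    using assms(2) [of x] by (simp add: complex_nonneg_Reals_iff Re_cinner)
qed


section \<open>Polynomials in a self-adjoint operator\<close>

lemma blinfun_compose_scaleR: "(r *\<^sub>R A) o\<^sub>L B = r *\<^sub>R (A o\<^sub>L B)" "A o\<^sub>L (r *\<^sub>R B) = r *\<^sub>R (A o\<^sub>L B)"
  by (rule blinfun_eqI, simp add: blinfun.scaleR_left blinfun.scaleR_right)+

lemma blinfun_compose_add: "(A + B) o\<^sub>L C = (A o\<^sub>L C) + (B o\<^sub>L C)" "A o\<^sub>L (B + C) = (A o\<^sub>L B) + (A o\<^sub>L C)"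
  by (rule blinfun_eqI, simp add: blinfun.add_left blinfun.add_right)+

lemma blinfun_compose_sum_right: "A o\<^sub>L (\<Sum>k\<in>I. f k) = (\<Sum>k\<in>I. A o\<^sub>L f k)"
  by (rule bounded_bilinear.sum_right [OF bounded_bilinear_blinfun_compose])

lemma poly_op_0 [simp]: "poly_op 0 A = 0"
  by (simp add: poly_op_def)

text \<open>Horner's rule, from which the algebra of \<open>poly_op\<close> follows by induction
  over \<open>pCons\<close>. The zero polynomial is a separate case because \<open>pCons c 0\<close>
  does not gain a degree.\<close>

lemma poly_op_pCons: "poly_op (pCons c p) A = c *\<^sub>R id_blinfun + (A o\<^sub>L poly_op p A)"
proof (cases "p = 0")
  case True
  then show ?thesis by (simp add: poly_op_def)
next
  case False
  then show ?thesis
    by (simp add: poly_op_def sum.atMost_Suc_shift blinfun_compose_sum_right blinfun_compose_scaleR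
        del: sum.atMost_Suc)
qed

lemma poly_op_const [simp]: "poly_op [:c:] A = c *\<^sub>R id_blinfun"
  by (simp add: poly_op_pCons)

lemma poly_op_add: "poly_op (p + q) A = poly_op p A + poly_op q A"
  by (induction p q rule: poly_induct2) (simp_all add: poly_op_pCons blinfun_compose_add scaleR_add_left)

lemma poly_op_smult: "poly_op (smult c p) A = c *\<^sub>R poly_op p A"
  by (induction p) (simp_all add: poly_op_pCons blinfun_compose_scaleR scaleR_add_right)

lemma poly_op_diff: "poly_op (p - q) A = poly_op p A - poly_op q A"
  using poly_op_add [of p "- q" A] poly_op_smult [of "-1" q A] by simp

lemma poly_op_mult: "poly_op (p * q) A = poly_op p A o\<^sub>L poly_op q A"
  by (induction p)
    (simp_all add: poly_op_pCons poly_op_add poly_op_smult blinfun_compose_add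
      blinfun_compose_scaleR blinfun_compose_assoc)

lemma poly_op_pcompose: "poly_op (pcompose p q) A = poly_op p (poly_op q A)"
  by (induction p) (simp_all add: pcompose_pCons poly_op_pCons poly_op_add poly_op_mult)

lemma poly_op_commute: "poly_op p A o\<^sub>L poly_op q A = poly_op q A o\<^sub>L poly_op p A"
  by (simp add: poly_op_mult [symmetric] mult.commute)

lemma poly_op_X [simp]: "poly_op [:0, 1:] A = A"
  by (simp add: poly_op_pCons)

lemma selfadjoint_poly_op:
  assumes "selfadjoint_op A"
  shows "selfadjoint_op (poly_op p A)"
proof (induction p)
  case 0
  show ?case using selfadjoint_op_scaleR [of id_blinfun 0] by simp
next
  case (pCons c p)
  have "selfadjoint_op (A o\<^sub>L poly_op p A)"
    using assms pCons poly_op_commute [of "[:0, 1:]" A p] by (simp add: selfadjoint_op_compose_commute)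
  then show ?case
    by (simp add: poly_op_pCons selfadjoint_op_add selfadjoint_op_scaleR)
qed

section \<open>Factorization of real polynomials and the norm bound on the spectrum\<close>

lemma map_poly_complex_of_real_mult:
  "map_poly complex_of_real (p * q) = map_poly complex_of_real p * map_poly complex_of_real q"
  by (rule poly_eqI) (simp add: coeff_map_poly coeff_mult)

lemma map_poly_complex_of_real_add:
  "map_poly complex_of_real (p + q) = map_poly complex_of_real p + map_poly complex_of_real q"
  by (rule poly_eqI) (simp add: coeff_map_poly)

text \<open>A complex root z is either real, which gives a linear factor, or yields the divisor d =
  (x - Re z)^2 + (Im z)^2: the remainder modulo d is u + v x with u and v real and vanishes at z, so
  v = 0 and then u = 0. The quadratic stays a sum of squares for the sake of self-adjoint
  operators.\<close>

lemma real_poly_factor_cases: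
  fixes p :: "real poly"
  assumes "degree p > 0"
  obtains r q where "p = [:- r, 1:] * q" "q \<noteq> 0" "degree q < degree p"
    | a b q where "b \<noteq> 0" "p = ([:- a, 1:]\<^sup>2 + [:b\<^sup>2:]) * q" "q \<noteq> 0" "degree q < degree p"
proof -
  let ?C = "map_poly complex_of_real"
  have "degree (?C p) > 0"
    using assms by (simp add: degree_map_poly)
  then have "\<not> constant (poly (?C p))"
    by (simp add: constant_degree)
  then obtain z where z: "poly (?C p) z = 0"
    using fundamental_theorem_of_algebra by blast
  have p: "p \<noteq> 0" using assms by auto
  show thesis
  proof (cases "Im z = 0")
    case True
    have "poly (?C p) (of_real (Re z)) = of_real (poly p (Re z))"
      by (induction p) (auto simp: map_poly_pCons)
    then have "poly p (Re z) = 0"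
      using z True by (metis complex_is_Real_iff of_real_Re of_real_eq_0_iff)
    then obtain q where q: "p = [:- Re z, 1:] * q"
      by (metis poly_eq_0_iff_dvd dvdE)
    with p have "q \<noteq> 0" by auto
    moreover from this have "degree q < degree p"
      unfolding q by (subst degree_mult_eq) auto
    ultimately show thesis using q that(1) by blast
  next
    case False
    define d :: "real poly" where "d = [:- Re z, 1:]\<^sup>2 + [:(Im z)\<^sup>2:]"
    have d': "d = [:(Re z)\<^sup>2 + (Im z)\<^sup>2, - 2 * Re z, 1:]"
      by (simp add: d_def power2_eq_square)
    have dz: "poly (?C d) z = 0"
      by (simp add: d' map_poly_pCons complex_eq_iff power2_eq_square algebra_simps)
    have deg: "degree d = 2" "d \<noteq> 0" by (auto simp: d')
    have "p mod d = 0"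
    proof (rule ccontr)
      assume "p mod d \<noteq> 0"
      then have "degree (p mod d) < 2"
        using degree_mod_less' [OF deg(2), of p] deg by simp
      then have "p mod d = [:coeff (p mod d) 0, coeff (p mod d) 1:]"
        by (intro poly_eqI) (auto simp: coeff_pCons coeff_eq_0 split: nat.split)
      then obtain u v where uv: "p mod d = [:u, v:]" by blast
      have "?C p = ?C (d * (p div d)) + ?C (p mod d)"
        by (simp flip: map_poly_complex_of_real_add)
      then have "poly (?C (p mod d)) z = 0"
        using z dz by (simp add: map_poly_complex_of_real_mult)
      then have "v * Im z = 0 \<and> u + v * Re z = 0"
        by (simp add: uv map_poly_pCons complex_eq_iff mult_ac)
      then show False
        using False \<open>p mod d \<noteq> 0\<close> by (auto simp: uv)
    qed
    then obtain q where q: "p = d * q" by (metis mod_0_imp_dvd dvdE)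
    with p have "q \<noteq> 0" by auto
    moreover from this have "degree q < degree p"
      unfolding q by (subst degree_mult_eq) (use deg in auto)
    ultimately show thesis using q that(2) [of "Im z" "Re z" q] False by (simp add: d_def)
  qed
qed

text \<open>This is the set on which \<open>cfun_op\<close> takes uniform limits; with it, non-real
  spectral points never come up.\<close>

definition real_spectrum :: "('a::complex_inner \<Rightarrow>\<^sub>L 'a) \<Rightarrow> real set" where
  "real_spectrum A = {x. complex_of_real x \<in> spectrum_op A}"

lemma not_in_real_spectrum: "r \<notin> real_spectrum A \<longleftrightarrow> invertible_op (A - r *\<^sub>R id_blinfun)"
  by (simp add: real_spectrum_def spectrum_op_def Blinfun_scaleC_of_real)

text \<open>Lower bounds multiply under composition, so it suffices to treat the factors. For r off
  the spectrum A - r is invertible; for self-adjoint S the quadratic form of S^2 + b^2 is at least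
  b^2 times the squared norm. Asking for a lower bound instead of an inverse avoids
  completeness.\<close>

lemma poly_op_bounded_below:
  fixes A :: "'a::complex_inner \<Rightarrow>\<^sub>L 'a"
  assumes A: "selfadjoint_op A"
  shows "p \<noteq> 0 \<Longrightarrow> (\<And>r. r \<in> real_spectrum A \<Longrightarrow> poly p r \<noteq> 0) \<Longrightarrow>
    \<exists>c>0. \<forall>x. c * norm x \<le> norm (blinfun_apply (poly_op p A) x)"
proof (induction "degree p" arbitrary: p rule: less_induct)
  case less
  have step: "\<exists>c>0. \<forall>x. c * norm x \<le> norm (blinfun_apply (poly_op (d * q) A) x)"
    if q: "p = d * q" "q \<noteq> 0" "degree q < degree p"
      and d: "e > 0" "\<And>x. e * norm x \<le> norm (blinfun_apply (poly_op d A) x)" for d q e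
  proof -
    obtain c where c: "c > 0" "\<And>x. c * norm x \<le> norm (blinfun_apply (poly_op q A) x)"
      using less.hyps [of q] less.prems q by (metis mult_zero_right poly_mult)
    have "e * c * norm x \<le> norm (blinfun_apply (poly_op (d * q) A) x)" for x
    proof -
      have "e * (c * norm x) \<le> e * norm (blinfun_apply (poly_op q A) x)"
        using c d by (intro mult_left_mono) auto
      also have "\<dots> \<le> norm (blinfun_apply (poly_op d A) (blinfun_apply (poly_op q A) x))"
        by (rule d)
      finally show ?thesis by (simp add: poly_op_mult mult.assoc)
    qed
    then show ?thesis using c d by (intro exI [of _ "e * c"]) auto
  qed
  show ?case
  proof (cases "degree p = 0")
    case True
    then obtain c where "p = [:c:]" by (metis degree_eq_zeroE)
    then show ?thesis
      using less.prems by (intro exI [of _ "\<bar>c\<bar>"]) (auto simp: blinfun.scaleR_left)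
  next
    case False
    then have "degree p > 0" by simp
    then show ?thesis
    proof (cases rule: real_poly_factor_cases)
      case (1 r q)
      have "r \<notin> real_spectrum A" using less.prems(2) [of r] 1 by auto
      then obtain e where "e > 0" "\<And>x. e * norm x \<le> norm (blinfun_apply (A - r *\<^sub>R id_blinfun) x)"
        using not_in_real_spectrum invertible_op_bounded_below by metis
      then show ?thesis
        using step [of "[:- r, 1:]" q e] 1 by (simp add: poly_op_pCons)
    next
      case (2 a b q)
      define S where "S = poly_op [:- a, 1:] A"
      have S: "selfadjoint_op S" unfolding S_def by (rule selfadjoint_poly_op [OF A])
      have D: "poly_op ([:- a, 1:]\<^sup>2 + [:b\<^sup>2:]) A = (S o\<^sub>L S) + b\<^sup>2 *\<^sub>R id_blinfun"
        by (simp only: poly_op_add power2_eq_square [of "[:- a, 1:]"] poly_op_mult S_def poly_op_const)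
      have "b\<^sup>2 * norm x \<le> norm (blinfun_apply (poly_op ([:- a, 1:]\<^sup>2 + [:b\<^sup>2:]) A) x)" for x
      proof (cases "x = 0")
        case False
        let ?y = "blinfun_apply (poly_op ([:- a, 1:]\<^sup>2 + [:b\<^sup>2:]) A) x"
        have "inner x ?y = inner (blinfun_apply S x) (blinfun_apply S x) + b\<^sup>2 * inner x x"
          unfolding D by (simp add: blinfun.add_left blinfun.scaleR_left inner_add_right
              selfadjoint_op_inner [OF S, symmetric] del: dot_square_norm)
        then have "b\<^sup>2 * norm x * norm x \<le> inner x ?y"
          by (simp add: power2_norm_eq_inner [symmetric] power2_eq_square [of "norm x"])
        also have "\<dots> \<le> norm ?y * norm x"
          using norm_cauchy_schwarz [of x ?y] by (simp add: mult.commute)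
        finally show ?thesis using False by simp
      qed simp
      then show ?thesis
        using step [OF 2(2-4), of "b\<^sup>2"] 2 by simp
    qed
  qed
qed

text \<open>A vector on which S nearly attains its norm s is nearly annihilated by S^2 - s^2, as
  \<open>key\<close> makes precise. A lower bound for that operator would give S a norm bound below
  s, so only the zero space admits one.\<close>

lemma square_minus_norm_bounded_below:
  fixes S :: "'a::complex_inner \<Rightarrow>\<^sub>L 'a"
  assumes S: "selfadjoint_op S" and c: "c > 0"
    and below: "\<And>x. c * norm x \<le> norm (blinfun_apply ((S o\<^sub>L S) - (norm S)\<^sup>2 *\<^sub>R id_blinfun) x)"
  shows "(x :: 'a) = 0"
proof -
  define s where "s = norm S"
  have s: "s \<ge> 0" by (simp add: s_def)
  have key: "(c * norm x)\<^sup>2 \<le> s\<^sup>2 * (s\<^sup>2 * (norm x)\<^sup>2 - (norm (blinfun_apply S x))\<^sup>2)" for x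
  proof -
    let ?y = "blinfun_apply S x" and ?z = "blinfun_apply S (blinfun_apply S x)"
    have "(c * norm x)\<^sup>2 \<le> (norm (?z - s\<^sup>2 *\<^sub>R x))\<^sup>2"
      using below [of x] c
      by (intro power_mono) (auto simp: blinfun.diff_left blinfun.scaleR_left s_def)
    also have "\<dots> = (norm ?z)\<^sup>2 - 2 * s\<^sup>2 * inner x ?z + (s\<^sup>2)\<^sup>2 * (norm x)\<^sup>2"
      unfolding power2_norm_eq_inner
      by (simp add: inner_diff_left inner_diff_right inner_commute power2_eq_square [of "s\<^sup>2"]
          algebra_simps del: dot_square_norm)
    also have "inner x ?z = (norm ?y)\<^sup>2"
      by (simp add: selfadjoint_op_inner [OF S, symmetric] power2_norm_eq_inner)
    also have "(norm ?z)\<^sup>2 \<le> s\<^sup>2 * (norm ?y)\<^sup>2"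
      using norm_blinfun [of S ?y] by (simp add: s_def power_mono flip: power_mult_distrib)
    finally show ?thesis by (simp add: algebra_simps power2_eq_square)
  qed
  show ?thesis
  proof (cases "s = 0")
    case True
    then show ?thesis using key [of x] c by simp
  next
    case False
    then have s0: "s > 0" using s by simp
    \<comment> \<open>Solving \<open>key\<close> for the squared norm of S x gives the factor s^2 -
      (c / s)^2; the maximum keeps the radicand nonnegative.\<close>
    define t where "t = sqrt (max 0 (s\<^sup>2 - (c / s)\<^sup>2))"
    have "norm (blinfun_apply S x) \<le> t * norm x" for x
    proof (rule power2_le_imp_le)
      have "(norm (blinfun_apply S x))\<^sup>2 \<le> (s\<^sup>2 - (c / s)\<^sup>2) * (norm x)\<^sup>2"
        using key [of x] s0 by (simp add: field_simps power2_eq_square)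
      also have "\<dots> \<le> t\<^sup>2 * (norm x)\<^sup>2"
        by (intro mult_right_mono) (auto simp: t_def)
      finally show "(norm (blinfun_apply S x))\<^sup>2 \<le> (t * norm x)\<^sup>2"
        by (simp add: power_mult_distrib)
    qed (simp add: t_def)
    then have "s \<le> t"
      unfolding s_def by (intro norm_blinfun_bound) (auto simp: t_def)
    moreover have "t < s"
      using s0 c by (auto simp: t_def max_def intro: real_less_lsqrt)
    ultimately show ?thesis by simp
  qed
qed

text \<open>If \<open>\<parallel>p(A)\<parallel>\<close> exceeded \<open>M\<close>, the polynomial \<open>p\<^sup>2 - \<parallel>p(A)\<parallel>\<^sup>2\<close> would have no zero on the spectrum,
  so its value at \<open>A\<close> would be bounded below.  When that polynomial is \<open>0\<close>, the spectrum is empty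
  and \<open>x\<^sup>2 - \<parallel>A\<parallel>\<^sup>2\<close> takes its place.\<close>

lemma norm_poly_op_le:
  fixes A :: "'a::complex_inner \<Rightarrow>\<^sub>L 'a"
  assumes A: "selfadjoint_op A" and M: "0 \<le> M"
    and le: "\<And>r. r \<in> real_spectrum A \<Longrightarrow> \<bar>poly p r\<bar> \<le> M"
  shows "norm (poly_op p A) \<le> M"
proof (rule ccontr)
  assume "\<not> norm (poly_op p A) \<le> M"
  then have gt: "M < norm (poly_op p A)" by simp
  have trivial: "\<forall>x :: 'a. x = 0"
    if p: "p * p - [:(norm (poly_op p A))\<^sup>2:] \<noteq> 0"
      and zeros: "\<And>r. r \<in> real_spectrum A \<Longrightarrow> poly (p * p - [:(norm (poly_op p A))\<^sup>2:]) r \<noteq> 0" for p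
  proof -
    let ?S = "poly_op p A"
    obtain c where c: "c > 0"
      "\<And>x. c * norm x \<le> norm (blinfun_apply (poly_op (p * p - [:(norm (poly_op p A))\<^sup>2:]) A) x)"
      using poly_op_bounded_below [OF A p zeros] by blast
    have "x = 0" for x :: 'a
      by (rule square_minus_norm_bounded_below [OF selfadjoint_poly_op [OF A, of p] c(1)])
        (use c(2) in \<open>simp add: poly_op_diff poly_op_mult\<close>)
    then show ?thesis by blast
  qed
  have nz: "poly (p * p - [:(norm (poly_op p A))\<^sup>2:]) r \<noteq> 0" if "r \<in> real_spectrum A" for r
  proof -
    have "\<bar>poly p r\<bar>\<^sup>2 < (norm (poly_op p A))\<^sup>2"
      using le [OF that] gt by (intro power_strict_mono) auto
    then show ?thesis by (simp add: power2_eq_square)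
  qed
  have "\<forall>x :: 'a. x = 0"
  proof (cases "p * p - [:(norm (poly_op p A))\<^sup>2:] = 0")
    case True
    then have "real_spectrum A = {}" using nz by auto
    then show ?thesis
      by (intro trivial [of "[:0, 1:]"]) auto
  next
    case False
    then show ?thesis using nz by (rule trivial)
  qed
  then have "poly_op p A = 0" by (metis blinfun_eqI)
  then show False using gt M by simp
qed


section \<open>Continuous functional calculus\<close>

text \<open>With a Banach codomain the operators form a complete space, so Cauchy sequences
  \<open>poly_op (p n) A\<close> have limits.\<close>

instance chilbert_space \<subseteq> banach ..

lemma op_between_selfadjoint: "op_between a b A \<Longrightarrow> selfadjoint_op A"
  by (simp add: op_between_def)

lemma op_between_mono:
  assumes "op_between a b A" "a' \<le> a" "b \<le> b'"
  shows "op_between a' b' A"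
proof -
  have "a' * (norm x)\<^sup>2 \<le> a * (norm x)\<^sup>2" "b * (norm x)\<^sup>2 \<le> b' * (norm x)\<^sup>2" for x :: 'a
    using assms by (auto intro: mult_right_mono)
  then show ?thesis
    using assms(1) unfolding op_between_def by (meson order_trans)
qed

text \<open>For r off {a..b}, either A - r or r - A has a coercive quadratic form, and Lax--Milgram
  inverts it.\<close>

lemma real_spectrum_between:
  fixes A :: "'a::chilbert_space \<Rightarrow>\<^sub>L 'a"
  assumes A: "op_between a b A"
  shows "real_spectrum A \<subseteq> {a..b}"
proof
  fix r assume r: "r \<in> real_spectrum A"
  have cl: "clinear_op (A - r *\<^sub>R id_blinfun)" "clinear_op (r *\<^sub>R id_blinfun - A)"
    using A by (auto simp: op_between_def selfadjoint_op_clinear intro!: clinear_op_diff clinear_op_scaleR)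
  have "a \<le> r"
  proof (rule ccontr)
    assume "\<not> a \<le> r"
    then have "invertible_op (A - r *\<^sub>R id_blinfun)"
      using A by (intro coercive_invertible_op [OF cl(1), of "a - r"])
        (auto simp: op_between_def blinfun.diff_left blinfun.scaleR_left inner_diff_right
          power2_norm_eq_inner algebra_simps)
    then show False using r not_in_real_spectrum by blast
  qed
  moreover have "r \<le> b"
  proof (rule ccontr)
    assume "\<not> r \<le> b"
    then have "invertible_op (r *\<^sub>R id_blinfun - A)"
      using A by (intro coercive_invertible_op [OF cl(2), of "r - b"])
        (auto simp: op_between_def blinfun.diff_left blinfun.scaleR_left inner_diff_right
          power2_norm_eq_inner algebra_simps)
    then have "invertible_op (A - r *\<^sub>R id_blinfun)"
      using invertible_op_minus by fastforce
    then show False using r not_in_real_spectrum by blast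
  qed
  ultimately show "r \<in> {a..b}" by simp
qed

lemma poly_op_diff_norm_less:
  fixes A :: "'a::complex_inner \<Rightarrow>\<^sub>L 'a"
  assumes A: "selfadjoint_op A" and "e > 0"
    and pq: "\<And>r. r \<in> real_spectrum A \<Longrightarrow> dist (poly p r) (f r) < e / 3"
      "\<And>r. r \<in> real_spectrum A \<Longrightarrow> dist (poly q r) (f r) < e / 3"
  shows "dist (poly_op p A) (poly_op q A) < e"
proof -
  \<comment> \<open>Thirds leave room for a strict inequality, as \<open>norm_poly_op_le\<close>
    gives only a weak one.\<close>
  have "norm (poly_op (p - q) A) \<le> 2 * e / 3"
  proof (rule norm_poly_op_le [OF A])
    show "\<bar>poly (p - q) r\<bar> \<le> 2 * e / 3" if "r \<in> real_spectrum A" for r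
      using pq(1) [OF that] pq(2) [OF that] unfolding dist_real_def poly_diff by linarith
  qed (use \<open>e > 0\<close> in simp)
  then show ?thesis
    using \<open>e > 0\<close> by (simp add: poly_op_diff dist_norm)
qed

text \<open>By the norm bound, polynomials with the same uniform limit on the spectrum have operator
  values that draw together. Comparing a sequence with itself gives existence in the definite
  description of \<open>cfun_op\<close>, comparing two sequences gives uniqueness. The hypothesis is
  on {a..b}, where approximations are available; competing sequences need converge only on the
  spectrum.\<close>

lemma poly_op_tendsto_cfun_op:
  fixes A :: "'a::chilbert_space \<Rightarrow>\<^sub>L 'a"
  assumes A: "op_between a b A"
    and p: "uniform_limit {a..b} (\<lambda>n x. poly (p n) x) f sequentially"
  shows "(\<lambda>n. poly_op (p n) A) \<longlonglongrightarrow> cfun_op f A"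
proof -
  note sa = op_between_selfadjoint [OF A]
  have p: "uniform_limit (real_spectrum A) (\<lambda>n x. poly (p n) x) f sequentially"
    using p real_spectrum_between [OF A] by (rule uniform_limit_on_subset)
  have close: "\<exists>N. \<forall>m\<ge>N. \<forall>n\<ge>N. dist (poly_op (q m) A) (poly_op (q' n) A) < e"
    if q: "uniform_limit (real_spectrum A) (\<lambda>n x. poly (q n) x) f sequentially"
      "uniform_limit (real_spectrum A) (\<lambda>n x. poly (q' n) x) f sequentially" and "e > 0"
    for q q' and e :: real
  proof -
    have e: "e / 3 > 0" using \<open>e > 0\<close> by simp
    obtain N where N: "\<forall>n\<ge>N. \<forall>x\<in>real_spectrum A. dist (poly (q n) x) (f x) < e / 3"
      using q(1) e unfolding uniform_limit_sequentially_iff by blast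
    obtain N' where N': "\<forall>n\<ge>N'. \<forall>x\<in>real_spectrum A. dist (poly (q' n) x) (f x) < e / 3"
      using q(2) e unfolding uniform_limit_sequentially_iff by blast
    show ?thesis
      using N N' \<open>e > 0\<close>
      by (intro exI [of _ "max N N'"]) (auto intro!: poly_op_diff_norm_less [OF sa, where f = f])
  qed
  have "Cauchy (\<lambda>n. poly_op (p n) A)"
    unfolding Cauchy_def using close [OF p p] by blast
  then obtain T where T: "(\<lambda>n. poly_op (p n) A) \<longlonglongrightarrow> T"
    using Cauchy_convergent convergent_def by blast
  have "cfun_op f A = T"
    unfolding cfun_op_def real_spectrum_def [symmetric]
  proof (rule the_equality)
    show "\<exists>p. uniform_limit (real_spectrum A) (\<lambda>n x. poly (p n) x) f sequentially \<and>
        (\<lambda>n. poly_op (p n) A) \<longlonglongrightarrow> T"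
      using p T by blast
    fix T'
    assume "\<exists>p. uniform_limit (real_spectrum A) (\<lambda>n x. poly (p n) x) f sequentially \<and>
        (\<lambda>n. poly_op (p n) A) \<longlonglongrightarrow> T'"
    then obtain q where q: "uniform_limit (real_spectrum A) (\<lambda>n x. poly (q n) x) f sequentially"
      and T': "(\<lambda>n. poly_op (q n) A) \<longlonglongrightarrow> T'" by blast
    have "(\<lambda>n. dist (poly_op (q n) A) (poly_op (p n) A)) \<longlonglongrightarrow> 0"
      unfolding lim_sequentially dist_real_def using close [OF q p] by fastforce
    moreover have "(\<lambda>n. dist (poly_op (q n) A) (poly_op (p n) A)) \<longlonglongrightarrow> dist T' T"
      using T' T by (rule tendsto_dist)
    ultimately show "T' = T"
      using LIMSEQ_unique by fastforce
  qed
  then show ?thesis using T by simp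
qed

lemma continuous_poly_uniform_limit:
  fixes f :: "real \<Rightarrow> real"
  assumes "continuous_on {a..b} f"
  obtains p where "uniform_limit {a..b} (\<lambda>n x. poly (p n) x) f sequentially"
proof -
  obtain g where g: "uniform_limit {a..b} g f sequentially" "\<And>n. polynomial_function (g n)"
    using Stone_Weierstrass_uniform_limit [OF compact_Icc assms] by metis
  have "\<exists>p. g n = poly p" for n
  proof -
    have "real_polynomial_function (g n)"
      using g(2) by (simp add: real_polynomial_function_eq)
    then obtain c k where "g n = (\<lambda>x. \<Sum>i\<le>k. c i * x ^ i)"
      using real_polynomial_function_iff_sum by blast
    then have "g n = poly (\<Sum>i\<le>k. monom (c i) i)"
      by (auto simp: poly_sum poly_monom)
    then show ?thesis by blast
  qed
  then obtain p where "\<And>n. g n = poly (p n)" by metis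
  then have "g = (\<lambda>n x. poly (p n) x)" by auto
  then show thesis using g that by simp
qed

lemma cfun_op_mult:
  fixes A :: "'a::chilbert_space \<Rightarrow>\<^sub>L 'a"
  assumes A: "op_between a b A" and f: "continuous_on {a..b} f" and g: "continuous_on {a..b} g"
  shows "cfun_op (\<lambda>x. f x * g x) A = cfun_op f A o\<^sub>L cfun_op g A"
proof -
  obtain p where p: "uniform_limit {a..b} (\<lambda>n x. poly (p n) x) f sequentially"
    using continuous_poly_uniform_limit [OF f] .
  obtain q where q: "uniform_limit {a..b} (\<lambda>n x. poly (q n) x) g sequentially"
    using continuous_poly_uniform_limit [OF g] .
  have "bounded (f ` {a..b})" "bounded (g ` {a..b})"
    using f g by (auto intro!: compact_imp_bounded compact_continuous_image)
  then have "uniform_limit {a..b} (\<lambda>n x. poly (p n * q n) x) (\<lambda>x. f x * g x) sequentially"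
    using uniform_lim_mult [OF p q] by simp
  then have "(\<lambda>n. poly_op (p n) A o\<^sub>L poly_op (q n) A) \<longlonglongrightarrow> cfun_op (\<lambda>x. f x * g x) A"
    using poly_op_tendsto_cfun_op [OF A] by (simp flip: poly_op_mult)
  moreover have "(\<lambda>n. poly_op (p n) A o\<^sub>L poly_op (q n) A) \<longlonglongrightarrow> (cfun_op f A o\<^sub>L cfun_op g A)"
    by (intro bounded_bilinear.tendsto [OF bounded_bilinear_blinfun_compose]
        poly_op_tendsto_cfun_op [OF A] p q)
  ultimately show ?thesis by (rule LIMSEQ_unique)
qed

lemma cfun_op_poly:
  fixes A :: "'a::chilbert_space \<Rightarrow>\<^sub>L 'a"
  assumes A: "op_between a b A" and f: "\<And>x. x \<in> {a..b} \<Longrightarrow> f x = poly p x"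
  shows "cfun_op f A = poly_op p A"
proof -
  have "uniform_limit {a..b} (\<lambda>n x. poly p x) f sequentially"
    using f by (auto simp: uniform_limit_sequentially_iff)
  then have "(\<lambda>n::nat. poly_op p A) \<longlonglongrightarrow> cfun_op f A"
    by (rule poly_op_tendsto_cfun_op [OF A])
  then show ?thesis by (simp add: LIMSEQ_const_iff)
qed

lemma selfadjoint_cfun_op:
  fixes A :: "'a::chilbert_space \<Rightarrow>\<^sub>L 'a"
  assumes A: "op_between a b A" and f: "continuous_on {a..b} f"
  shows "selfadjoint_op (cfun_op f A)"
proof -
  obtain p where p: "uniform_limit {a..b} (\<lambda>n x. poly (p n) x) f sequentially"
    using continuous_poly_uniform_limit [OF f] .
  show ?thesis
    by (rule selfadjoint_op_limit [OF _ poly_op_tendsto_cfun_op [OF A p]])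
      (rule selfadjoint_poly_op [OF op_between_selfadjoint [OF A]])
qed

text \<open>Diagonal choice: q n is within 1 / (n + 1) of f n on the interval, and so is its value
  at A of \<open>cfun_op (f n) A\<close>. Hence q n tends to g uniformly, which identifies the
  limit.\<close>

lemma cfun_op_tendsto:
  fixes A :: "'a::chilbert_space \<Rightarrow>\<^sub>L 'a"
  assumes A: "op_between a b A" and f: "\<And>n. continuous_on {a..b} (f n)"
    and lim: "uniform_limit {a..b} f g sequentially"
  shows "(\<lambda>n. cfun_op (f n) A) \<longlonglongrightarrow> cfun_op g A"
proof -
  have "\<exists>q. (\<forall>x\<in>{a..b}. dist (poly q x) (f n x) < 1 / Suc n) \<and>
      dist (poly_op q A) (cfun_op (f n) A) < 1 / Suc n" for n
  proof -
    obtain p where p: "uniform_limit {a..b} (\<lambda>n x. poly (p n) x) (f n) sequentially"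
      using continuous_poly_uniform_limit [OF f] .
    have "eventually (\<lambda>k. (\<forall>x\<in>{a..b}. dist (poly (p k) x) (f n x) < 1 / Suc n) \<and>
        dist (poly_op (p k) A) (cfun_op (f n) A) < 1 / Suc n) sequentially"
      by (intro eventually_conj uniform_limitD [OF p] tendstoD [OF poly_op_tendsto_cfun_op [OF A p]]) auto
    then show ?thesis
      using eventually_happens' [OF sequentially_bot] by blast
  qed
  then obtain q where q: "\<And>n x. x \<in> {a..b} \<Longrightarrow> dist (poly (q n) x) (f n x) < 1 / Suc n"
    "\<And>n. dist (poly_op (q n) A) (cfun_op (f n) A) < 1 / Suc n"
    by metis
  have inv: "(\<lambda>n. 1 / real (Suc n)) \<longlonglongrightarrow> 0"
    using LIMSEQ_inverse_real_of_nat by (simp add: inverse_eq_divide)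
  have "uniform_limit {a..b} (\<lambda>n x. poly (q n) x - f n x) (\<lambda>_. 0) sequentially"
    unfolding uniform_limit_iff
  proof (intro allI impI)
    fix e :: real assume "e > 0"
    then have "eventually (\<lambda>n. 1 / real (Suc n) < e) sequentially"
      using order_tendstoD(2) [OF inv] by blast
    then show "eventually (\<lambda>n. \<forall>x\<in>{a..b}. dist (poly (q n) x - f n x) 0 < e) sequentially"
      by eventually_elim (metis (no_types) q(1) dist_norm diff_zero order_less_trans)
  qed
  from uniform_limit_add [OF this lim]
  have "uniform_limit {a..b} (\<lambda>n x. poly (q n) x) g sequentially" by simp
  then have "(\<lambda>n. poly_op (q n) A) \<longlonglongrightarrow> cfun_op g A"
    by (rule poly_op_tendsto_cfun_op [OF A])
  moreover have "(\<lambda>n. poly_op (q n) A - cfun_op (f n) A) \<longlonglongrightarrow> 0"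
    using inv by (rule tendsto_0_le [where K = 1])
      (use q(2) in \<open>auto simp: dist_norm intro!: always_eventually less_imp_le\<close>)
  ultimately have "(\<lambda>n. poly_op (q n) A - (poly_op (q n) A - cfun_op (f n) A)) \<longlonglongrightarrow> cfun_op g A - 0"
    by (rule tendsto_diff)
  then show ?thesis by simp
qed

text \<open>Composing with p turns polynomials that approximate f on {c..d} into polynomials that
  approximate the composite on {a..b}, and \<open>poly_op\<close> respects composition.\<close>

lemma cfun_op_poly_op:
  fixes A :: "'a::chilbert_space \<Rightarrow>\<^sub>L 'a"
  assumes A: "op_between a b A" and pA: "op_between c d (poly_op p A)"
    and range: "\<And>x. x \<in> {a..b} \<Longrightarrow> poly p x \<in> {c..d}" and f: "continuous_on {c..d} f"
  shows "cfun_op f (poly_op p A) = cfun_op (\<lambda>x. f (poly p x)) A"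
proof -
  obtain q where q: "uniform_limit {c..d} (\<lambda>n x. poly (q n) x) f sequentially"
    using continuous_poly_uniform_limit [OF f] .
  have "uniform_limit {a..b} (\<lambda>n x. poly (pcompose (q n) p) x) (\<lambda>x. f (poly p x)) sequentially"
    unfolding poly_pcompose by (rule uniform_limit_compose' [OF q]) (use range in auto)
  from poly_op_tendsto_cfun_op [OF A this] poly_op_tendsto_cfun_op [OF pA q]
  show ?thesis by (simp add: poly_op_pcompose LIMSEQ_unique)
qed


section \<open>Powers of strictly positive operators\<close>

lemma continuous_on_powr_Icc: "0 < a \<Longrightarrow> continuous_on {a..b} (\<lambda>x :: real. x powr t)"
  by (intro continuous_intros) auto

lemma selfadjoint_powr_op:
  fixes A :: "'a::chilbert_space \<Rightarrow>\<^sub>L 'a"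
  assumes "strictly_positive_op A"
  shows "selfadjoint_op (powr_op A t)"
  using strictly_positive_op_between [OF assms]
  by (metis powr_op_def selfadjoint_cfun_op continuous_on_powr_Icc)

lemma powr_op_add:
  fixes A :: "'a::chilbert_space \<Rightarrow>\<^sub>L 'a"
  assumes "strictly_positive_op A"
  shows "powr_op A (s + t) = powr_op A s o\<^sub>L powr_op A t"
proof -
  obtain a b where ab: "0 < a" "op_between a b A"
    using strictly_positive_op_between [OF assms] by metis
  show ?thesis
    unfolding powr_op_def powr_add
    by (rule cfun_op_mult [OF ab(2)]) (rule continuous_on_powr_Icc [OF ab(1)])+
qed

lemma powr_op_0 [simp]:
  fixes A :: "'a::chilbert_space \<Rightarrow>\<^sub>L 'a"
  assumes "strictly_positive_op A"
  shows "powr_op A 0 = id_blinfun"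
proof -
  obtain a b where ab: "0 < a" "op_between a b A"
    using strictly_positive_op_between [OF assms] by metis
  show ?thesis
    unfolding powr_op_def using ab by (subst cfun_op_poly [where p = "[:1:]"]) auto
qed

lemma powr_op_1 [simp]:
  fixes A :: "'a::chilbert_space \<Rightarrow>\<^sub>L 'a"
  assumes "strictly_positive_op A"
  shows "powr_op A 1 = A"
proof -
  obtain a b where ab: "0 < a" "op_between a b A"
    using strictly_positive_op_between [OF assms] by metis
  show ?thesis
    unfolding powr_op_def using ab by (subst cfun_op_poly [where p = "[:0, 1:]"]) auto
qed

lemma powr_op_tendsto:
  fixes A :: "'a::chilbert_space \<Rightarrow>\<^sub>L 'a"
  assumes A: "strictly_positive_op A" and r: "r \<longlonglongrightarrow> t"
  shows "(\<lambda>n. powr_op A (r n)) \<longlonglongrightarrow> powr_op A t"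
proof -
  obtain a b where ab: "0 < a" "op_between a b A"
    using strictly_positive_op_between [OF A] by metis
  have "uniform_limit {a..b} (\<lambda>n x. x powr r n) (\<lambda>x. x powr t) sequentially"
    unfolding uniform_limit_iff
  proof (intro allI impI)
    fix e :: real assume "e > 0"
    \<comment> \<open>Compactness in base and exponent together makes the estimate uniform in the
      base x; the radius 1 is arbitrary.\<close>
    have "uniformly_continuous_on ({a..b} \<times> cball t 1) (\<lambda>(x, s). x powr s)"
      using ab by (intro compact_uniformly_continuous compact_Times)
        (auto simp: case_prod_unfold intro!: continuous_intros)
    then obtain d where d: "d > 0"
      "\<And>u v. u \<in> {a..b} \<times> cball t 1 \<Longrightarrow> v \<in> {a..b} \<times> cball t 1 \<Longrightarrow> dist v u < d \<Longrightarrow>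
        dist ((\<lambda>(x, s). x powr s) v) ((\<lambda>(x, s). x powr s) u) < e"
      using \<open>e > 0\<close> unfolding uniformly_continuous_on_def by metis
    have "eventually (\<lambda>n. dist (r n) t < min d 1) sequentially"
      using d(1) by (intro tendstoD [OF r]) simp
    then show "eventually (\<lambda>n. \<forall>x\<in>{a..b}. dist (x powr r n) (x powr t) < e) sequentially"
    proof eventually_elim
      case (elim n)
      show ?case
      proof
        fix x assume "x \<in> {a..b}"
        then show "dist (x powr r n) (x powr t) < e"
          using d(2) [of "(x, t)" "(x, r n)"] elim by (simp add: dist_Pair_Pair dist_commute)
      qed
    qed
  qed
  then show ?thesis
    unfolding powr_op_def
    by (intro cfun_op_tendsto [OF ab(2)] continuous_on_powr_Icc [OF ab(1)])
qed

lemma powr_op_root: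
  fixes A :: "'a::chilbert_space \<Rightarrow>\<^sub>L 'a"
  assumes A: "strictly_positive_op A" and An: "strictly_positive_op (poly_op ([:0, 1:] ^ n) A)"
    and n: "n > 0"
  shows "powr_op (poly_op ([:0, 1:] ^ n) A) (1 / real n) = A"
proof -
  obtain a b where ab: "0 < a" "op_between a b A"
    using strictly_positive_op_between [OF A] by metis
  obtain c d where cd: "0 < c" "op_between c d (poly_op ([:0, 1:] ^ n) A)"
    using strictly_positive_op_between [OF An] by metis
  have "cfun_op (\<lambda>x. x powr (1 / real n)) (poly_op ([:0, 1:] ^ n) A) =
      cfun_op (\<lambda>x. poly ([:0, 1:] ^ n) x powr (1 / real n)) A"
  proof (rule cfun_op_poly_op [OF ab(2) op_between_mono [OF cd(2)]])
    \<comment> \<open>The bounds c and d need not enclose the values x^n for x in {a..b}, so they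
      are widened; the lower end stays positive.\<close>
    show "min c (a ^ n) \<le> c" "d \<le> max d (b ^ n)" by auto
    show "poly ([:0, 1:] ^ n) x \<in> {min c (a ^ n)..max d (b ^ n)}" if "x \<in> {a..b}" for x
      using that ab by (auto simp: poly_power min_le_iff_disj le_max_iff_disj intro!: power_mono)
    show "continuous_on {min c (a ^ n)..max d (b ^ n)} (\<lambda>x. x powr (1 / real n))"
      using ab cd by (intro continuous_on_powr_Icc) auto
  qed
  also have "\<dots> = A"
  proof -
    have "(x ^ n) powr (1 / real n) = x" if "x \<in> {a..b}" for x
      using that ab n by (simp add: powr_powr flip: powr_realpow)
    then show ?thesis
      by (subst cfun_op_poly [OF ab(2), where p = "[:0, 1:]"]) (auto simp: poly_power)
  qed
  finally show ?thesis by (simp add: powr_op_def)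
qed

text \<open>E t is the square of the self-adjoint E (t/2), hence positive, and E (- t) inverts
  it.\<close>

lemma selfadjoint_group_strictly_positive:
  fixes E :: "real \<Rightarrow> 'a::complex_inner \<Rightarrow>\<^sub>L 'a"
  assumes sa: "\<And>t. selfadjoint_op (E t)" and add: "\<And>s t. E (s + t) = E s o\<^sub>L E t"
    and zero: "E 0 = id_blinfun"
  shows "strictly_positive_op (E t)"
  unfolding strictly_positive_op_def invertible_op_def
proof (intro conjI exI)
  show "positive_op (E t)"
  proof (rule selfadjoint_op_positiveI [OF sa])
    fix x
    have "inner x (blinfun_apply (E t) x) = inner x (blinfun_apply (E (t/2)) (blinfun_apply (E (t/2)) x))"
      using add [of "t/2" "t/2"] by simp
    also have "\<dots> = (norm (blinfun_apply (E (t/2)) x))\<^sup>2"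
      by (simp add: selfadjoint_op_inner [OF sa, symmetric] power2_norm_eq_inner)
    finally show "0 \<le> inner x (blinfun_apply (E t) x)" by simp
  qed
  show "clinear_op (E (- t))" using sa by (rule selfadjoint_op_clinear)
  show "E t o\<^sub>L E (- t) = id_blinfun" "E (- t) o\<^sub>L E t = id_blinfun"
    using zero by (simp_all flip: add)
qed

lemma strictly_positive_powr_op:
  fixes A :: "'a::chilbert_space \<Rightarrow>\<^sub>L 'a"
  assumes "strictly_positive_op A"
  shows "strictly_positive_op (powr_op A t)"
  using selfadjoint_group_strictly_positive [of "powr_op A"] assms
  by (simp add: selfadjoint_powr_op powr_op_add)

text \<open>Powers are written as values of \<open>[:0, 1:] ^ m\<close>, the form in which
  \<open>powr_op_root\<close> extracts roots. This serves both a given group and the powers of its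
  value at 1.\<close>

lemma group_multiple_poly_op:
  assumes "\<And>s t. E (s + t) = E s o\<^sub>L E t" "E 0 = id_blinfun"
  shows "E (real m * s) = poly_op ([:0, 1:] ^ m) (E s)"
proof (induction m)
  case 0
  show ?case using assms(2) by (simp add: one_pCons)
next
  case (Suc m)
  have "E (real (Suc m) * s) = E s o\<^sub>L E (real m * s)"
    by (simp add: distrib_right flip: assms(1))
  then show ?case
    by (simp only: Suc power_Suc poly_op_mult poly_op_X)
qed

text \<open>Both sides are continuous in \<open>t\<close>; they agree at \<open>1 / n\<close> by uniqueness of positive \<open>n\<close>-th roots,
  hence at all nonnegative rationals.\<close>

lemma powr_op_selfadjoint_group:
  fixes E :: "real \<Rightarrow> 'a::chilbert_space \<Rightarrow>\<^sub>L 'a"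
  assumes sa: "\<And>t. selfadjoint_op (E t)" and add: "\<And>s t. E (s + t) = E s o\<^sub>L E t"
    and zero: "E 0 = id_blinfun" and cont: "\<And>r t. r \<longlonglongrightarrow> t \<Longrightarrow> (\<lambda>n. E (r n)) \<longlonglongrightarrow> E t"
  shows "powr_op (E 1) t = E t"
proof -
  note pos = selfadjoint_group_strictly_positive [of E, OF sa add zero]
  let ?F = "powr_op (E 1)"
  have root: "?F (1 / real n) = E (1 / real n)" if "n > 0" for n
  proof -
    have "E 1 = poly_op ([:0, 1:] ^ n) (E (1 / real n))"
      using group_multiple_poly_op [of E n "1 / real n", OF add zero] that by simp
    with powr_op_root [of "E (1 / real n)" n] that pos show ?thesis by metis
  qed
  have rat: "?F (real m / real n) = E (real m / real n)" if "n > 0" for m n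
  proof -
    have "?F (real m * (1 / real n)) = poly_op ([:0, 1:] ^ m) (?F (1 / real n))"
      by (rule group_multiple_poly_op [of ?F, OF powr_op_add [OF pos] powr_op_0 [OF pos]])
    also have "\<dots> = E (real m * (1 / real n))"
      by (simp only: root [OF that] group_multiple_poly_op [of E, OF add zero])
    finally show ?thesis by simp
  qed
  have nonneg: "?F t = E t" if "t \<ge> 0" for t
  proof -
    \<comment> \<open>Rationals from below with error at most 1 / (n + 1); \<open>nat\<close> loses
      nothing as t \<ge> 0, and \<open>Suc n\<close> avoids the denominator 0.\<close>
    define r where "r n = real (nat \<lfloor>t * real (Suc n)\<rfloor>) / real (Suc n)" for n
    have "norm (r n - t) \<le> norm (inverse (real (Suc n))) * 1" for n
    proof -
      have "\<bar>real (nat \<lfloor>t * real (Suc n)\<rfloor>) - t * real (Suc n)\<bar> \<le> 1"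
        using that by (simp add: abs_le_iff) linarith
      then have "\<bar>real (nat \<lfloor>t * real (Suc n)\<rfloor>) - t * real (Suc n)\<bar> / real (Suc n) \<le> 1 / real (Suc n)"
        by (intro divide_right_mono) auto
      moreover have "r n - t = (real (nat \<lfloor>t * real (Suc n)\<rfloor>) - t * real (Suc n)) / real (Suc n)"
        by (simp add: r_def diff_divide_distrib)
      ultimately show ?thesis by (simp add: inverse_eq_divide)
    qed
    then have "(\<lambda>n. r n - t) \<longlonglongrightarrow> 0"
      by (intro tendsto_0_le [OF LIMSEQ_inverse_real_of_nat, where K = 1] always_eventually allI)
    then have r: "r \<longlonglongrightarrow> t" by (simp add: LIM_zero_iff)
    have "?F (r n) = E (r n)" for n
      unfolding r_def by (rule rat) simp
    then show ?thesis
      using powr_op_tendsto [OF pos [of 1] r] cont [OF r] by (simp add: LIMSEQ_unique)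
  qed
  show ?thesis
  proof (cases "t \<ge> 0")
    case False
    \<comment> \<open>For t < 0, both operators are inverse to their common value at - t.\<close>
    have "?F t = ?F t o\<^sub>L (E (- t) o\<^sub>L E t)"
      using zero by (simp flip: add)
    also have "\<dots> = (?F t o\<^sub>L ?F (- t)) o\<^sub>L E t"
      using False by (simp add: nonneg blinfun_compose_assoc)
    also have "\<dots> = E t"
      by (simp add: pos flip: powr_op_add)
    finally show ?thesis .
  qed (rule nonneg)
qed


section \<open>Tensor products of operators\<close>

text \<open>The seminorm of the difference is computed from \<open>ts_form\<close>, so agreement
  against all formal sums makes it 0. Bilinearity of elementary tensors thus reduces to bilinearity
  of the form.\<close>

lemma formal_sum_eqI:
  assumes "\<And>r. ts_form r s = ts_form r t"
  shows "formal_sum s = formal_sum t"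
proof -
  have "dist (formal_sum s) (formal_sum t) = 0"
    unfolding dist_formal_sum using assms by (intro ts_norm_0I) simp
  then show ?thesis by simp
qed

lemma formal_sum_append: "formal_sum (s @ t) = formal_sum s + formal_sum t"
  by (simp add: formal_sum_eq)

lemma formal_sum_scale: "formal_sum (ts_scale c s) = c *\<^sub>C formal_sum s"
  by (simp add: formal_sum_abs scaleC_htensor.abs_eq ts_equiv_refl)

lemma formal_sum_diff: "formal_sum (ts_diff s t) = formal_sum s - formal_sum t"
  by (simp add: ts_diff_def formal_sum_append formal_sum_scale)

lemma norm_formal_sum: "norm (formal_sum s) = ts_norm s"
  by (simp add: norm_eq_sqrt_inner Re_cinner [symmetric] cinner_formal_sum ts_norm_def)

lemma tensor_vec_add_left: "(x + x') \<otimes>\<^sub>v y = x \<otimes>\<^sub>v y + x' \<otimes>\<^sub>v y"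
  unfolding tensor_vec_def formal_sum_append [symmetric]
  by (rule formal_sum_eqI)
    (simp add: ts_form_def case_prod_unfold cinner_add_right distrib_right sum_list_addf)

lemma tensor_vec_add_right: "x \<otimes>\<^sub>v (y + y') = x \<otimes>\<^sub>v y + x \<otimes>\<^sub>v y'"
  unfolding tensor_vec_def formal_sum_append [symmetric]
  by (rule formal_sum_eqI)
    (simp add: ts_form_def case_prod_unfold cinner_add_right distrib_left sum_list_addf)

lemma tensor_vec_scaleC_left: "(c *\<^sub>C x) \<otimes>\<^sub>v y = c *\<^sub>C (x \<otimes>\<^sub>v y)"
  by (simp add: tensor_vec_def formal_sum_scale [symmetric] ts_scale_def)

lemma tensor_vec_scaleC_right: "x \<otimes>\<^sub>v (c *\<^sub>C y) = c *\<^sub>C (x \<otimes>\<^sub>v y)"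
  unfolding tensor_vec_def formal_sum_scale [symmetric]
  by (rule formal_sum_eqI) (simp add: ts_form_def ts_scale_def case_prod_unfold mult_ac)

lemma tensor_vec_scaleR_left: "(r *\<^sub>R x) \<otimes>\<^sub>v y = r *\<^sub>R (x \<otimes>\<^sub>v y)"
  by (simp only: scaleC_of_real [symmetric] tensor_vec_scaleC_left)

lemma tensor_vec_scaleR_right: "x \<otimes>\<^sub>v (r *\<^sub>R y) = r *\<^sub>R (x \<otimes>\<^sub>v y)"
  by (simp only: scaleC_of_real [symmetric] tensor_vec_scaleC_right)

lemma tensor_vec_zero_right [simp]: "x \<otimes>\<^sub>v 0 = 0"
  using tensor_vec_scaleR_right [of x 0 0] by simp

lemma tensor_vec_sum_right: "x \<otimes>\<^sub>v (\<Sum>i\<in>I. f i) = (\<Sum>i\<in>I. x \<otimes>\<^sub>v f i)"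
  by (induction I rule: infinite_finite_induct) (auto simp: tensor_vec_add_right)

lemma norm_tensor_vec: "norm (x \<otimes>\<^sub>v y) = norm x * norm y"
proof (rule power2_eq_imp_eq)
  have "complex_of_real ((norm (x \<otimes>\<^sub>v y))\<^sup>2) = complex_of_real ((norm x * norm y)\<^sup>2)"
    using cinner_tensor_vec [of x y x y] by (simp add: cinner_self power_mult_distrib power2_norm_eq_inner
          del: dot_square_norm of_real_power)
  then show "(norm (x \<otimes>\<^sub>v y))\<^sup>2 = (norm x * norm y)\<^sup>2"
    by (simp only: of_real_eq_iff)
qed simp_all

text \<open>The vectors \<open>z k\<close> and \<open>e k\<close> do not depend on \<open>A\<close>, which reduces the bound on \<open>A \<otimes> 1\<close> to
  orthogonal second factors.\<close>

lemma formal_sum_orthogonal: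
  fixes s :: "('a::complex_inner \<times> 'b::complex_inner) list"
  shows "\<exists>n (z :: nat \<Rightarrow> 'a) (e :: nat \<Rightarrow> 'b). (\<forall>j<n. \<forall>k<n. j \<noteq> k \<longrightarrow> \<langle>e j, e k\<rangle> = 0) \<and>
    (\<forall>A :: 'a \<Rightarrow>\<^sub>L 'a. clinear_op A \<longrightarrow> formal_sum (map (map_prod (blinfun_apply A) id) s) =
      (\<Sum>k<n. blinfun_apply A (z k) \<otimes>\<^sub>v e k))"
proof (induction s)
  case Nil
  show ?case by (rule exI [of _ 0]) (simp add: formal_sum_eq)
next
  case (Cons p s)
  obtain x y where p: "p = (x, y)" by fastforce
  from Cons.IH obtain n and z :: "nat \<Rightarrow> 'a" and e :: "nat \<Rightarrow> 'b"
    where *: "(\<forall>j<n. \<forall>k<n. j \<noteq> k \<longrightarrow> \<langle>e j, e k\<rangle> = 0) \<and>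
      (\<forall>A :: 'a \<Rightarrow>\<^sub>L 'a. clinear_op A \<longrightarrow> formal_sum (map (map_prod (blinfun_apply A) id) s) =
        (\<Sum>k<n. blinfun_apply A (z k) \<otimes>\<^sub>v e k))"
    by (elim exE) (rule that)
  have orth: "\<langle>e j, e k\<rangle> = 0" if "j < n" "k < n" "j \<noteq> k" for j k
    using * that by simp
  have form: "formal_sum (map (map_prod (blinfun_apply A) id) s) =
      (\<Sum>k<n. blinfun_apply A (z k) \<otimes>\<^sub>v e k)" if "clinear_op A" for A :: "'a \<Rightarrow>\<^sub>L 'a"
    using * that by simp
  \<comment> \<open>Gram--Schmidt without normalization: if some e k is 0, the quotient is 0 by
    convention and orthogonality to e k is trivial.\<close>
  define c where "c k = \<langle>e k, y\<rangle> / \<langle>e k, e k\<rangle>" for k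
  define r where "r = y - (\<Sum>k<n. c k *\<^sub>C e k)"
  have er: "\<langle>e j, r\<rangle> = 0" if "j < n" for j
  proof -
    have "(\<Sum>k<n. c k * \<langle>e j, e k\<rangle>) = (\<Sum>k<n. if k = j then c j * \<langle>e j, e j\<rangle> else 0)"
      using orth that by (intro sum.cong) auto
    then have "\<langle>e j, r\<rangle> = \<langle>e j, y\<rangle> - c j * \<langle>e j, e j\<rangle>"
      using that by (simp add: r_def cinner_diff_right cinner_sum_right)
    then show ?thesis
      by (auto simp: c_def)
  qed
  have re: "\<langle>r, e j\<rangle> = 0" if "j < n" for j
    using er [OF that] by (subst cinner_commute) simp
  have y: "y = (\<Sum>k<n. c k *\<^sub>C e k) + r"
    by (simp add: r_def)
  define z' where "z' k = (if k < n then z k + c k *\<^sub>C x else x)" for k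
  define e' where "e' k = (if k < n then e k else r)" for k
  have "formal_sum (map (map_prod (blinfun_apply A) id) (p # s)) =
      (\<Sum>k<Suc n. blinfun_apply A (z' k) \<otimes>\<^sub>v e' k)" if A: "clinear_op A" for A :: "'a \<Rightarrow>\<^sub>L 'a"
  proof -
    have "formal_sum (map (map_prod (blinfun_apply A) id) (p # s)) =
        blinfun_apply A x \<otimes>\<^sub>v y + (\<Sum>k<n. blinfun_apply A (z k) \<otimes>\<^sub>v e k)"
      by (simp add: p formal_sum_eq flip: form [OF A])
    also have "blinfun_apply A x \<otimes>\<^sub>v y =
        (\<Sum>k<n. c k *\<^sub>C (blinfun_apply A x \<otimes>\<^sub>v e k)) + blinfun_apply A x \<otimes>\<^sub>v r"
      by (subst y) (simp add: tensor_vec_add_right tensor_vec_sum_right tensor_vec_scaleC_right)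
    finally have eq: "formal_sum (map (map_prod (blinfun_apply A) id) (p # s)) =
        (\<Sum>k<n. c k *\<^sub>C (blinfun_apply A x \<otimes>\<^sub>v e k)) + blinfun_apply A x \<otimes>\<^sub>v r +
        (\<Sum>k<n. blinfun_apply A (z k) \<otimes>\<^sub>v e k)" .
    show ?thesis
      unfolding eq by (simp add: z'_def e'_def blinfun.add_right clinear_op_scaleC [OF A] tensor_vec_add_left
          tensor_vec_scaleC_left sum.distrib)
  qed
  moreover have "\<forall>j<Suc n. \<forall>k<Suc n. j \<noteq> k \<longrightarrow> \<langle>e' j, e' k\<rangle> = 0"
    using orth er re by (auto simp: e'_def less_Suc_eq)
  ultimately show ?case by blast
qed

lemma norm_sum_tensor_orthogonal:
  fixes e :: "nat \<Rightarrow> 'b::complex_inner" and z :: "nat \<Rightarrow> 'a::complex_inner"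
  assumes "\<And>j k. j < n \<Longrightarrow> k < n \<Longrightarrow> j \<noteq> k \<Longrightarrow> \<langle>e j, e k\<rangle> = 0"
  shows "(norm (\<Sum>k<n. z k \<otimes>\<^sub>v e k))\<^sup>2 = (\<Sum>k<n. (norm (z k) * norm (e k))\<^sup>2)"
  using assms
  by (subst norm_sum_Pythagorean)
    (auto simp: pairwise_def orthogonal_def Re_cinner [symmetric] cinner_tensor_vec norm_tensor_vec)

lemma norm_formal_sum_map_left:
  fixes A :: "'a::complex_inner \<Rightarrow>\<^sub>L 'a" and s :: "('a \<times> 'b::complex_inner) list"
  assumes "clinear_op A"
  shows "norm (formal_sum (map (map_prod (blinfun_apply A) id) s)) \<le> norm A * norm (formal_sum s)"
proof -
  obtain n and z :: "nat \<Rightarrow> 'a" and e :: "nat \<Rightarrow> 'b"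
    where *: "(\<forall>j<n. \<forall>k<n. j \<noteq> k \<longrightarrow> \<langle>e j, e k\<rangle> = 0) \<and>
      (\<forall>A :: 'a \<Rightarrow>\<^sub>L 'a. clinear_op A \<longrightarrow> formal_sum (map (map_prod (blinfun_apply A) id) s) =
        (\<Sum>k<n. blinfun_apply A (z k) \<otimes>\<^sub>v e k))"
    using formal_sum_orthogonal [of s] by (elim exE) (rule that)
  have orth: "\<langle>e j, e k\<rangle> = 0" if "j < n" "k < n" "j \<noteq> k" for j k
    using * that by simp
  have form: "formal_sum (map (map_prod (blinfun_apply A) id) s) =
      (\<Sum>k<n. blinfun_apply A (z k) \<otimes>\<^sub>v e k)" if "clinear_op A" for A :: "'a \<Rightarrow>\<^sub>L 'a"
    using * that by simp
  \<comment> \<open>The identity operator expresses s itself through the same z and e, so the two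
    norms can be compared term by term.\<close>
  have "map_prod (blinfun_apply id_blinfun) id = (id :: 'a \<times> 'b \<Rightarrow> _)"
    by auto
  with form [OF clinear_op_id] have s: "formal_sum s = (\<Sum>k<n. z k \<otimes>\<^sub>v e k)"
    by simp
  show ?thesis
  proof (rule power2_le_imp_le)
    have "(norm (formal_sum (map (map_prod (blinfun_apply A) id) s)))\<^sup>2 =
        (\<Sum>k<n. (norm (blinfun_apply A (z k)) * norm (e k))\<^sup>2)"
      unfolding form [OF assms] by (rule norm_sum_tensor_orthogonal) (rule orth)
    also have "\<dots> \<le> (\<Sum>k<n. (norm A * norm (z k) * norm (e k))\<^sup>2)"
      by (intro sum_mono power_mono mult_right_mono norm_blinfun) auto
    also have "\<dots> = (norm A)\<^sup>2 * (\<Sum>k<n. (norm (z k) * norm (e k))\<^sup>2)"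
      by (simp add: sum_distrib_left power_mult_distrib mult_ac)
    also have "\<dots> = (norm A * norm (formal_sum s))\<^sup>2"
      unfolding s by (simp add: norm_sum_tensor_orthogonal [OF orth] power_mult_distrib)
    finally show "(norm (formal_sum (map (map_prod (blinfun_apply A) id) s)))\<^sup>2 \<le>
        (norm A * norm (formal_sum s))\<^sup>2" .
  qed simp
qed

lemma norm_formal_sum_swap: "norm (formal_sum (map prod.swap s)) = norm (formal_sum s)"
proof -
  have "ts_form (map prod.swap s) (map prod.swap t) = ts_form s t" for t
    by (simp add: ts_form_def case_prod_unfold o_def mult.commute)
  then show ?thesis
    by (simp add: norm_formal_sum ts_norm_def)
qed

text \<open>The action of B on the second factors comes first, then that of A on the first ones;
  swapping the factors is isometric and reduces the former to the case already treated.\<close>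

lemma norm_formal_sum_map:
  fixes A :: "'a::complex_inner \<Rightarrow>\<^sub>L 'a" and B :: "'b::complex_inner \<Rightarrow>\<^sub>L 'b"
  assumes A: "clinear_op A" and B: "clinear_op B"
  shows "norm (formal_sum (map (map_prod (blinfun_apply A) (blinfun_apply B)) s))
    \<le> norm A * norm B * norm (formal_sum s)"
proof -
  let ?s = "map (map_prod (blinfun_apply B) id) (map prod.swap s)"
  have "map (map_prod (blinfun_apply A) (blinfun_apply B)) s =
      map (map_prod (blinfun_apply A) id) (map prod.swap ?s)"
    by (auto simp: map_prod_def case_prod_unfold)
  then have "norm (formal_sum (map (map_prod (blinfun_apply A) (blinfun_apply B)) s))
      \<le> norm A * norm (formal_sum (map prod.swap ?s))"
    using norm_formal_sum_map_left [OF A] by metis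
  also have "norm (formal_sum (map prod.swap ?s)) = norm (formal_sum ?s)"
    by (rule norm_formal_sum_swap)
  also have "\<dots> \<le> norm B * norm (formal_sum s)"
    using norm_formal_sum_map_left [OF B, of "map prod.swap s"] by (simp add: norm_formal_sum_swap)
  finally show ?thesis
    by (simp add: mult_left_mono mult.assoc)
qed

text \<open>Extension by continuity from the dense formal sums. The map U on lists is Lipschitz for
  the distance of the represented vectors, so limits of U depend only on the vector approximated,
  whichever sequence is chosen.\<close>

lemma tensor_op_exists:
  fixes A :: "'a::complex_inner \<Rightarrow>\<^sub>L 'a" and B :: "'b::complex_inner \<Rightarrow>\<^sub>L 'b"
  assumes A: "clinear_op A" and B: "clinear_op B"
  shows "\<exists>T. clinear_op T \<and> norm T \<le> norm A * norm B \<and>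
    (\<forall>x y. blinfun_apply T (x \<otimes>\<^sub>v y) = blinfun_apply A x \<otimes>\<^sub>v blinfun_apply B y)"
proof -
  define U where "U s = formal_sum (map (map_prod (blinfun_apply A) (blinfun_apply B)) s)" for s
  let ?K = "norm A * norm B"
  have U_append: "U (s @ t) = U s + U t" for s t
    by (simp add: U_def formal_sum_append)
  have U_scale: "U (ts_scale c s) = c *\<^sub>C U s" for c s
    by (simp add: U_def formal_sum_scale [symmetric] ts_scale_def case_prod_unfold o_def
        clinear_op_scaleC [OF A])
  have U_dist: "dist (U s) (U t) \<le> ?K * dist (formal_sum s) (formal_sum t)" for s t
  proof -
    have "U s - U t = U (ts_diff s t)"
      by (simp add: ts_diff_def U_append U_scale)
    then show ?thesis
      using norm_formal_sum_map [OF A B, of "ts_diff s t"]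
      by (simp add: U_def dist_norm formal_sum_diff)
  qed
  define X where "X z = (SOME X. (\<lambda>n. formal_sum (X n)) \<longlonglongrightarrow> z)" for z :: "('a, 'b) htensor"
  have X: "(\<lambda>n. formal_sum (X z n)) \<longlonglongrightarrow> z" for z
    unfolding X_def
    using someI_ex [of "\<lambda>X. (\<lambda>n. formal_sum (X n)) \<longlonglongrightarrow> z"] htensor_approx [of z] by blast
  define T where "T z = lim (\<lambda>n. U (X z n))" for z
  have UX: "(\<lambda>n. U (X z n)) \<longlonglongrightarrow> T z" for z
  proof -
    have "Cauchy (\<lambda>n. U (X z n))"
      unfolding Cauchy_def
    proof (intro allI impI)
      fix d :: real assume "d > 0"
      then have "d / (?K + 1) > 0" by (simp add: add_nonneg_pos)
      then obtain N where N: "\<And>m n. m \<ge> N \<Longrightarrow> n \<ge> N \<Longrightarrow>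
          dist (formal_sum (X z m)) (formal_sum (X z n)) < d / (?K + 1)"
        using LIMSEQ_imp_Cauchy [OF X [of z]] unfolding Cauchy_def by meson
      have "dist (U (X z m)) (U (X z n)) < d" if "m \<ge> N" "n \<ge> N" for m n
      proof -
        have "dist (U (X z m)) (U (X z n)) \<le> (?K + 1) * dist (formal_sum (X z m)) (formal_sum (X z n))"
          using U_dist [of "X z m" "X z n"] by (simp add: distrib_right add_increasing2)
        also have "\<dots> < d"
          using N [OF that] by (simp add: pos_less_divide_eq add_nonneg_pos mult.commute)
        finally show ?thesis .
      qed
      then show "\<exists>N. \<forall>m\<ge>N. \<forall>n\<ge>N. dist (U (X z m)) (U (X z n)) < d" by blast
    qed
    then show ?thesis
      unfolding T_def by (simp add: Cauchy_convergent_iff convergent_LIMSEQ_iff)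
  qed
  have key: "(\<lambda>n. U (Y n)) \<longlonglongrightarrow> T z" if "(\<lambda>n. formal_sum (Y n)) \<longlonglongrightarrow> z" for Y z
  proof -
    have "(\<lambda>n. formal_sum (Y n) - formal_sum (X z n)) \<longlonglongrightarrow> 0"
      using tendsto_diff [OF that X [of z]] by simp
    then have "(\<lambda>n. U (Y n) - U (X z n)) \<longlonglongrightarrow> 0"
      by (rule tendsto_0_le [where K = ?K])
        (use U_dist in \<open>simp add: dist_norm mult.commute\<close>)
    from tendsto_add [OF this UX [of z]] show ?thesis by simp
  qed
  have T_add: "T (x + y) = T x + T y" for x y
  proof -
    have "(\<lambda>n. U (X x n @ X y n)) \<longlonglongrightarrow> T (x + y)"
      by (rule key) (auto simp: formal_sum_append intro!: tendsto_add X)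
    moreover have "(\<lambda>n. U (X x n @ X y n)) \<longlonglongrightarrow> T x + T y"
      by (auto simp: U_append intro!: tendsto_add UX)
    ultimately show ?thesis by (rule LIMSEQ_unique)
  qed
  have T_scale: "T (c *\<^sub>C x) = c *\<^sub>C T x" for c x
  proof -
    have "(\<lambda>n. U (ts_scale c (X x n))) \<longlonglongrightarrow> T (c *\<^sub>C x)"
      by (rule key)
        (auto simp: formal_sum_scale intro!: bounded_linear.tendsto [OF bounded_linear_scaleC] X)
    moreover have "(\<lambda>n. U (ts_scale c (X x n))) \<longlonglongrightarrow> c *\<^sub>C T x"
      by (auto simp: U_scale intro!: bounded_linear.tendsto [OF bounded_linear_scaleC] UX)
    ultimately show ?thesis by (rule LIMSEQ_unique)
  qed
  have T_norm: "norm (T x) \<le> ?K * norm x" for x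
  proof (rule LIMSEQ_le)
    show "(\<lambda>n. norm (U (X x n))) \<longlonglongrightarrow> norm (T x)"
      by (intro tendsto_norm UX)
    show "(\<lambda>n. ?K * norm (formal_sum (X x n))) \<longlonglongrightarrow> ?K * norm x"
      by (intro tendsto_mult_left tendsto_norm X)
    show "\<exists>N. \<forall>n\<ge>N. norm (U (X x n)) \<le> ?K * norm (formal_sum (X x n))"
      unfolding U_def using norm_formal_sum_map [OF A B] by blast
  qed
  have bl: "bounded_linear T"
  proof (rule bounded_linear_intro [where K = ?K])
    show "T (r *\<^sub>R x) = r *\<^sub>R T x" for r x
      by (simp only: scaleC_of_real [symmetric] T_scale)
  qed (use T_add T_norm in \<open>simp_all add: mult_ac\<close>)
  have T_tensor: "T (x \<otimes>\<^sub>v y) = blinfun_apply A x \<otimes>\<^sub>v blinfun_apply B y" for x y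
  proof -
    have "(\<lambda>n::nat. U [(x, y)]) \<longlonglongrightarrow> T (x \<otimes>\<^sub>v y)"
      by (rule key) (simp add: tensor_vec_def)
    then show ?thesis
      by (simp add: LIMSEQ_const_iff U_def tensor_vec_def)
  qed
  show ?thesis
    by (intro exI [of _ "Blinfun T"])
      (auto simp: clinear_op_def bounded_linear_Blinfun_apply [OF bl] T_scale T_norm T_tensor
        intro!: norm_blinfun_bound)
qed

text \<open>The vectors where f and g agree form a closed real subspace containing the elementary
  tensors, whose span is dense. Uniqueness in \<open>tensor_op\<close> and all identities below rest
  on this.\<close>

lemma bounded_linear_eq_on_tensors:
  assumes f: "bounded_linear f" and g: "bounded_linear g"
    and eq: "\<And>x y. f (x \<otimes>\<^sub>v y) = g (x \<otimes>\<^sub>v y)"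
  shows "f z = g z"
proof -
  interpret f: bounded_linear f by fact
  interpret g: bounded_linear g by fact
  have "closed {z. f z = g z}"
    by (intro closed_Collect_eq continuous_intros linear_continuous_on f g)
  moreover have "subspace {z. f z = g z}"
    by (auto simp: subspace_def f.zero g.zero f.add g.add f.scaleR g.scaleR)
  then have "span (range (\<lambda>(x, y). x \<otimes>\<^sub>v y)) \<subseteq> {z. f z = g z}"
    using eq by (intro span_minimal) auto
  ultimately have "closure (span (range (\<lambda>(x, y). x \<otimes>\<^sub>v y))) \<subseteq> {z. f z = g z}"
    by (simp add: closure_minimal)
  then show ?thesis
    unfolding closure_span_tensor_vec by blast
qed

lemma blinfun_eq_on_tensors:
  assumes "\<And>x y. blinfun_apply S (x \<otimes>\<^sub>v y) = blinfun_apply T (x \<otimes>\<^sub>v y)"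
  shows "S = T"
  by (rule blinfun_eqI)
    (rule bounded_linear_eq_on_tensors [OF blinfun.bounded_linear_right blinfun.bounded_linear_right assms])

lemma tensor_op_properties:
  assumes "clinear_op A" "clinear_op B"
  shows clinear_tensor_op: "clinear_op (A \<otimes>\<^sub>o B)"
    and norm_tensor_op_le: "norm (A \<otimes>\<^sub>o B) \<le> norm A * norm B"
    and tensor_op_apply:
      "\<And>x y. blinfun_apply (A \<otimes>\<^sub>o B) (x \<otimes>\<^sub>v y) = blinfun_apply A x \<otimes>\<^sub>v blinfun_apply B y"
proof -
  obtain T where T: "clinear_op T" "norm T \<le> norm A * norm B"
    "\<And>x y. blinfun_apply T (x \<otimes>\<^sub>v y) = blinfun_apply A x \<otimes>\<^sub>v blinfun_apply B y"
    using tensor_op_exists [OF assms] by blast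
  have "A \<otimes>\<^sub>o B = T"
    unfolding tensor_op_def
  proof (rule the_equality)
    fix T' assume "clinear_op T' \<and>
      (\<forall>x y. blinfun_apply T' (x \<otimes>\<^sub>v y) = blinfun_apply A x \<otimes>\<^sub>v blinfun_apply B y)"
    then show "T' = T"
      by (intro blinfun_eq_on_tensors) (simp add: T(3))
  qed (use T in simp)
  then show "clinear_op (A \<otimes>\<^sub>o B)" "norm (A \<otimes>\<^sub>o B) \<le> norm A * norm B"
    "\<And>x y. blinfun_apply (A \<otimes>\<^sub>o B) (x \<otimes>\<^sub>v y) = blinfun_apply A x \<otimes>\<^sub>v blinfun_apply B y"
    using T by simp_all
qed

section \<open>Algebra and continuity of tensor products of operators\<close>

lemma tensor_op_id [simp]: "id_blinfun \<otimes>\<^sub>o id_blinfun = id_blinfun"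
  by (rule blinfun_eq_on_tensors) (simp add: tensor_op_apply)

lemma tensor_op_compose:
  assumes "clinear_op A" "clinear_op B" "clinear_op C" "clinear_op D"
  shows "(A \<otimes>\<^sub>o B) o\<^sub>L (C \<otimes>\<^sub>o D) = (A o\<^sub>L C) \<otimes>\<^sub>o (B o\<^sub>L D)"
  by (rule blinfun_eq_on_tensors) (simp add: tensor_op_apply clinear_op_compose assms)

lemma tensor_op_add_left:
  assumes "clinear_op A" "clinear_op B" "clinear_op C"
  shows "(A + B) \<otimes>\<^sub>o C = A \<otimes>\<^sub>o C + B \<otimes>\<^sub>o C"
  by (rule blinfun_eq_on_tensors)
    (simp add: tensor_op_apply clinear_op_add blinfun.add_left tensor_vec_add_left assms)

lemma tensor_op_add_right:
  assumes "clinear_op A" "clinear_op B" "clinear_op C"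
  shows "A \<otimes>\<^sub>o (B + C) = A \<otimes>\<^sub>o B + A \<otimes>\<^sub>o C"
  by (rule blinfun_eq_on_tensors)
    (simp add: tensor_op_apply clinear_op_add blinfun.add_left tensor_vec_add_right assms)

lemma tensor_op_scaleR_left:
  assumes "clinear_op A" "clinear_op B"
  shows "(r *\<^sub>R A) \<otimes>\<^sub>o B = r *\<^sub>R (A \<otimes>\<^sub>o B)"
  by (rule blinfun_eq_on_tensors)
    (simp add: tensor_op_apply clinear_op_scaleR blinfun.scaleR_left tensor_vec_scaleR_left assms)

lemma tensor_op_scaleR_right:
  assumes "clinear_op A" "clinear_op B"
  shows "A \<otimes>\<^sub>o (r *\<^sub>R B) = r *\<^sub>R (A \<otimes>\<^sub>o B)"
  by (rule blinfun_eq_on_tensors)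
    (simp add: tensor_op_apply clinear_op_scaleR blinfun.scaleR_left tensor_vec_scaleR_right assms)

lemma tensor_op_diff_left:
  assumes "clinear_op A" "clinear_op B" "clinear_op C"
  shows "(A - B) \<otimes>\<^sub>o C = A \<otimes>\<^sub>o C - B \<otimes>\<^sub>o C"
  using tensor_op_add_left [of "A - B" B C] assms by (simp add: clinear_op_diff)

lemma tensor_op_diff_right:
  assumes "clinear_op A" "clinear_op B" "clinear_op C"
  shows "A \<otimes>\<^sub>o (B - C) = A \<otimes>\<^sub>o B - A \<otimes>\<^sub>o C"
  using tensor_op_add_right [of A "B - C" C] assms by (simp add: clinear_op_diff)

lemma bounded_linear_cinner_left: "bounded_linear (\<lambda>x. \<langle>x, y\<rangle>)"
proof -
  have "(\<lambda>x. \<langle>x, y\<rangle>) = (\<lambda>x. cnj \<langle>y, x\<rangle>)"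
    by (intro ext cinner_commute)
  then show ?thesis
    using bounded_linear_compose [OF bounded_linear_cnj bounded_linear_cinner_right] by simp
qed

text \<open>Density is used once in each argument of the inner product. The left argument is
  conjugate-linear, but real linearity is all that \<open>bounded_linear_eq_on_tensors\<close>
  asks.\<close>

lemma selfadjoint_tensor_op:
  assumes A: "selfadjoint_op A" and B: "selfadjoint_op B"
  shows "selfadjoint_op (A \<otimes>\<^sub>o B)"
  unfolding selfadjoint_op_def
proof (intro conjI allI)
  note cl = selfadjoint_op_clinear [OF A] selfadjoint_op_clinear [OF B]
  show "clinear_op (A \<otimes>\<^sub>o B)" by (rule clinear_tensor_op [OF cl])
  have 1: "\<langle>blinfun_apply (A \<otimes>\<^sub>o B) (u \<otimes>\<^sub>v v), z\<rangle> = \<langle>u \<otimes>\<^sub>v v, blinfun_apply (A \<otimes>\<^sub>o B) z\<rangle>" for u v z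
    by (rule bounded_linear_eq_on_tensors [where z = z])
      (auto intro!: bounded_linear_cinner_right
          bounded_linear_compose [OF bounded_linear_cinner_right blinfun.bounded_linear_right]
        simp: tensor_op_apply [OF cl] cinner_tensor_vec selfadjoint_op_cinner A B)
  fix w z
  show "\<langle>blinfun_apply (A \<otimes>\<^sub>o B) w, z\<rangle> = \<langle>w, blinfun_apply (A \<otimes>\<^sub>o B) z\<rangle>"
    by (rule bounded_linear_eq_on_tensors [where z = w])
      (auto intro!: bounded_linear_cinner_left
          bounded_linear_compose [OF bounded_linear_cinner_left blinfun.bounded_linear_right]
        simp: 1)
qed

text \<open>Bilinearity of \<open>tensor_op\<close> is established for complex-linear operators, not
  on the whole type of real-linear ones, so the usual telescoping is carried out with
  \<open>norm_tensor_op_le\<close>.\<close>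

lemma tensor_op_tendsto:
  assumes A: "\<And>n. clinear_op (A n)" "clinear_op S" "A \<longlonglongrightarrow> S"
    and B: "\<And>n. clinear_op (B n)" "clinear_op T" "B \<longlonglongrightarrow> T"
  shows "(\<lambda>n. A n \<otimes>\<^sub>o B n) \<longlonglongrightarrow> S \<otimes>\<^sub>o T"
proof -
  have "(\<lambda>n. norm (A n - S) * norm (B n) + norm S * norm (B n - T)) \<longlonglongrightarrow> 0 * norm T + norm S * 0"
    by (intro tendsto_add tendsto_mult tendsto_const tendsto_norm tendsto_norm_zero
        LIM_zero A(3) B(3))
  then have "(\<lambda>n. norm (A n - S) * norm (B n) + norm S * norm (B n - T)) \<longlonglongrightarrow> 0" by simp
  moreover have "eventually (\<lambda>n. norm (A n \<otimes>\<^sub>o B n - S \<otimes>\<^sub>o T) \<le>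
      norm (A n - S) * norm (B n) + norm S * norm (B n - T)) sequentially"
  proof (intro always_eventually allI)
    fix n
    have "A n \<otimes>\<^sub>o B n - S \<otimes>\<^sub>o T = (A n - S) \<otimes>\<^sub>o B n + S \<otimes>\<^sub>o (B n - T)"
      by (simp add: tensor_op_diff_left tensor_op_diff_right A B)
    also have "norm \<dots> \<le> norm ((A n - S) \<otimes>\<^sub>o B n) + norm (S \<otimes>\<^sub>o (B n - T))"
      by (rule norm_triangle_ineq)
    also have "\<dots> \<le> norm (A n - S) * norm (B n) + norm S * norm (B n - T)"
      by (intro add_mono norm_tensor_op_le clinear_op_diff A B)
    finally show "norm (A n \<otimes>\<^sub>o B n - S \<otimes>\<^sub>o T) \<le>
        norm (A n - S) * norm (B n) + norm S * norm (B n - T)" .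
  qed
  ultimately have "(\<lambda>n. A n \<otimes>\<^sub>o B n - S \<otimes>\<^sub>o T) \<longlonglongrightarrow> 0"
    by (rule Lim_null_comparison [rotated])
  then show ?thesis by (simp add: LIM_zero_iff)
qed

text \<open>The tensor products of the powers form a norm-continuous self-adjoint group. Strict
  positivity of its value at 1 comes from the group law rather than from the spectra of the
  factors.\<close>

lemma powr_tensor_op:
  fixes A :: "'a::chilbert_space \<Rightarrow>\<^sub>L 'a" and B :: "'b::chilbert_space \<Rightarrow>\<^sub>L 'b"
  assumes A: "strictly_positive_op A" and B: "strictly_positive_op B"
  shows "powr_op (A \<otimes>\<^sub>o B) t = powr_op A t \<otimes>\<^sub>o powr_op B t"
proof -
  define E where "E t = powr_op A t \<otimes>\<^sub>o powr_op B t" for t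
  note sa = selfadjoint_powr_op [OF A] selfadjoint_powr_op [OF B]
  note cl = sa [THEN selfadjoint_op_clinear]
  have sE: "selfadjoint_op (E t)" for t
    unfolding E_def by (intro selfadjoint_tensor_op sa)
  have E_add: "E (s + t) = E s o\<^sub>L E t" for s t
    unfolding E_def by (simp add: tensor_op_compose cl powr_op_add A B)
  have E_0: "E 0 = id_blinfun"
    by (simp add: E_def A B)
  have E_1: "E 1 = A \<otimes>\<^sub>o B"
    by (simp add: E_def A B)
  have "powr_op (E 1) t = E t"
    by (rule powr_op_selfadjoint_group [OF sE E_add E_0])
      (auto simp: E_def intro!: tensor_op_tendsto cl powr_op_tendsto A B)
  then show ?thesis
    by (simp add: E_1) (simp add: E_def)
qed

section \<open>Weighted geometric means and the entropy identity\<close>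

lemma invertible_op_compose:
  assumes "invertible_op A" "invertible_op B"
  shows "invertible_op (A o\<^sub>L B)"
proof -
  obtain A' where A': "clinear_op A'" "A o\<^sub>L A' = id_blinfun" "A' o\<^sub>L A = id_blinfun"
    using assms(1) by (auto simp: invertible_op_def)
  obtain B' where B': "clinear_op B'" "B o\<^sub>L B' = id_blinfun" "B' o\<^sub>L B = id_blinfun"
    using assms(2) by (auto simp: invertible_op_def)
  show ?thesis
    unfolding invertible_op_def
    by (intro exI [of _ "B' o\<^sub>L A'"] conjI clinear_op_compose A' B')
      (metis A' B' blinfun_compose_assoc blinfun_compose_id(1))+
qed

text \<open>The quadratic form of P B P at x is that of B at P x. This admits the middle factor of
  the geometric mean to the power lemmas.\<close>

lemma strictly_positive_op_conjugate:
  assumes P: "strictly_positive_op P" and B: "strictly_positive_op B"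
  shows "strictly_positive_op (P o\<^sub>L B o\<^sub>L P)"
proof -
  have sP: "selfadjoint_op P"
    using P by (simp add: strictly_positive_op_def positive_op_selfadjoint)
  have "positive_op (P o\<^sub>L B o\<^sub>L P)"
    using B sP
    by (simp add: strictly_positive_op_def positive_op_def clinear_op_compose selfadjoint_op_clinear
        flip: selfadjoint_op_cinner)
  moreover have "invertible_op (P o\<^sub>L B o\<^sub>L P)"
    using P B by (simp add: strictly_positive_op_def invertible_op_compose)
  ultimately show ?thesis by (simp add: strictly_positive_op_def)
qed

definition weighted_geometric_mean ::
    "real \<Rightarrow> ('a::chilbert_space \<Rightarrow>\<^sub>L 'a) \<Rightarrow> ('a \<Rightarrow>\<^sub>L 'a) \<Rightarrow> ('a \<Rightarrow>\<^sub>L 'a)" where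
  "weighted_geometric_mean t A B =
     powr_op A (1/2) o\<^sub>L powr_op (powr_op A (-1/2) o\<^sub>L B o\<^sub>L powr_op A (-1/2)) t o\<^sub>L powr_op A (1/2)"

lemma weighted_geometric_mean_tsallis_entropy:
  "t \<noteq> 0 \<Longrightarrow> weighted_geometric_mean t A B = A + t *\<^sub>R tsallis_entropy t A B"
  by (simp add: weighted_geometric_mean_def tsallis_entropy_def)

lemma clinear_tsallis_entropy:
  assumes "strictly_positive_op A" "strictly_positive_op B"
  shows "clinear_op (tsallis_entropy t A B)"
  unfolding tsallis_entropy_def
  by (intro clinear_op_scaleR clinear_op_diff clinear_op_compose selfadjoint_op_clinear
      selfadjoint_powr_op strictly_positive_op_conjugate strictly_positive_powr_op assms
      positive_op_selfadjoint [OF conjunct1 [OF assms(1) [unfolded strictly_positive_op_def]]])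

text \<open>\<open>powr_tensor_op\<close> splits the outer powers, the mixed product rule gathers
  the conjugated operator into a tensor product, and \<open>powr_tensor_op\<close> applies again to
  its t-th power because both conjugated factors are strictly positive.\<close>

lemma weighted_geometric_mean_tensor:
  fixes A\<^sub>1 B\<^sub>1 :: "'a::chilbert_space \<Rightarrow>\<^sub>L 'a" and A\<^sub>2 B\<^sub>2 :: "'b::chilbert_space \<Rightarrow>\<^sub>L 'b"
  assumes "strictly_positive_op A\<^sub>1" "strictly_positive_op B\<^sub>1"
    and "strictly_positive_op A\<^sub>2" "strictly_positive_op B\<^sub>2"
  shows "weighted_geometric_mean t (A\<^sub>1 \<otimes>\<^sub>o A\<^sub>2) (B\<^sub>1 \<otimes>\<^sub>o B\<^sub>2) =
    weighted_geometric_mean t A\<^sub>1 B\<^sub>1 \<otimes>\<^sub>o weighted_geometric_mean t A\<^sub>2 B\<^sub>2"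
proof -
  have cl: "clinear_op A" if "strictly_positive_op A" for A :: "'c::complex_inner \<Rightarrow>\<^sub>L 'c"
    using that by (simp add: strictly_positive_op_def positive_op_def)
  show ?thesis
    unfolding weighted_geometric_mean_def
    by (simp add: assms powr_tensor_op tensor_op_compose clinear_op_compose cl
        strictly_positive_powr_op strictly_positive_op_conjugate)
qed

theorem theorem4p2:
  fixes A\<^sub>1 B\<^sub>1 :: "'a::chilbert_space \<Rightarrow>\<^sub>L 'a"
    and A\<^sub>2 B\<^sub>2 :: "'b::chilbert_space \<Rightarrow>\<^sub>L 'b"
    and lam :: real
  assumes "0 < lam" and "lam \<le> 1"
    and "strictly_positive_op A\<^sub>1" and "strictly_positive_op B\<^sub>1"
    and "strictly_positive_op A\<^sub>2" and "strictly_positive_op B\<^sub>2"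
  shows "tsallis_entropy lam (A\<^sub>1 \<otimes>\<^sub>o A\<^sub>2) (B\<^sub>1 \<otimes>\<^sub>o B\<^sub>2) =
           tsallis_entropy lam A\<^sub>1 B\<^sub>1 \<otimes>\<^sub>o A\<^sub>2
         + A\<^sub>1 \<otimes>\<^sub>o tsallis_entropy lam A\<^sub>2 B\<^sub>2
         + lam *\<^sub>R (tsallis_entropy lam A\<^sub>1 B\<^sub>1 \<otimes>\<^sub>o tsallis_entropy lam A\<^sub>2 B\<^sub>2)"
proof -
  let ?T\<^sub>1 = "tsallis_entropy lam A\<^sub>1 B\<^sub>1" and ?T\<^sub>2 = "tsallis_entropy lam A\<^sub>2 B\<^sub>2"
  have cl: "clinear_op A\<^sub>1" "clinear_op A\<^sub>2" "clinear_op ?T\<^sub>1" "clinear_op ?T\<^sub>2"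
    using assms by (simp_all add: clinear_tsallis_entropy)
      (simp_all add: strictly_positive_op_def positive_op_def)
  have "A\<^sub>1 \<otimes>\<^sub>o A\<^sub>2 + lam *\<^sub>R tsallis_entropy lam (A\<^sub>1 \<otimes>\<^sub>o A\<^sub>2) (B\<^sub>1 \<otimes>\<^sub>o B\<^sub>2) =
      (A\<^sub>1 + lam *\<^sub>R ?T\<^sub>1) \<otimes>\<^sub>o (A\<^sub>2 + lam *\<^sub>R ?T\<^sub>2)"
    using weighted_geometric_mean_tensor [OF assms(3-6), of lam] \<open>0 < lam\<close>
    by (simp add: weighted_geometric_mean_tsallis_entropy)
  \<comment> \<open>The product of the two entropy terms carries lam squared; with one lam taken
    out, the other remains as its coefficient.\<close>
  also have "\<dots> = A\<^sub>1 \<otimes>\<^sub>o A\<^sub>2 + lam *\<^sub>R (?T\<^sub>1 \<otimes>\<^sub>o A\<^sub>2 + A\<^sub>1 \<otimes>\<^sub>o ?T\<^sub>2 + lam *\<^sub>R (?T\<^sub>1 \<otimes>\<^sub>o ?T\<^sub>2))"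
    by (simp add: cl tensor_op_add_left tensor_op_add_right tensor_op_scaleR_left
        tensor_op_scaleR_right clinear_op_add clinear_op_scaleR algebra_simps)
  finally show ?thesis
    using \<open>0 < lam\<close> by simp
qed

end
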